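(* Let $O$ be a subdomain of $\Omega$, and let $T:O\to\Omega$ be a holomorphic mapping. Then the following conditions are equivalent: (a) $\Delta_{zw}$ is $T$-invariant, that is, $\Delta_{zw}(F\circ T)=\Delta_{zw}(F)\circ T$ on $O$ for every $F\in\mathcal{H}(\Omega)$; (b) $T\in\mathcal{M}$, i.e. $T$ is the restriction to $O$ of an element of $\mathcal{M}$.
   Context: $\hat{\mathbb{C}}=\mathbb{C}\cup\{\infty\}$ is the Riemann sphere, with conventions $z\cdot\infty=\infty\cdot z=\infty$ for $z\in\hat{\mathbb{C}}\setminus\{0\}$ and $0\cdot\infty=\infty\cdot 0=1$. $\Omega:=\{(z,w)\in\hat{\mathbb{C}}^2: z\cdot w\neq 1\}$ is an open subset of $\hat{\mathbb{C}}^2$, a complex manifold of dimension 2 covered by the two charts $\phi_+(u,v)=(u,v)$ on $\Omega\cap\mathbb{C}^2$ and $\phi_-(u,v)=(1/v,1/u)$ on $\Omega\cap(\hat{\mathbb{C}}\setminus\{0\})^2$. $\mathcal{H}(U)$ denotes the holomorphic functions $U\to\mathbb{C}$. A subdomain is a non-empty connected open subset. The Laplacian on $\Omega$ is the operator given in each of these charts, with local coordinates $(z,w)\in\mathbb{C}^2$, by $\Delta_{zw}F(z,w)=4(1-zw)^2\,\partial_z\partial_wF(z,w)$; this is well defined and maps $\mathcal{H}(U)$ to $\mathcal{H}(U)$ for every open $U\subseteq\Omega$. $\operatorname{Aut}(\hat{\mathbb{C}})$ is the group of Möbius transformations of $\hat{\mathbb{C}}$, and $\mathcal{M}$ is the group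 of all biholomorphic self-maps of $\Omega$ of the form $(z,w)\mapsto\big(\psi(z),\tfrac{1}{\psi(1/w)}\big)$ or $(z,w)\mapsto\big(\psi(w),\tfrac{1}{\psi(1/z)}\big)$ with $\psi\in\operatorname{Aut}(\hat{\mathbb{C}})$. *)

theory Defs
  imports "HOL-Analysis.Analysis"
begin

section \<open>The Riemann sphere\<close>

text \<open>The point at infinity is \<^term>\<open>None\<close>.\<close>

type_synonym sphere = "complex option"

abbreviation infty :: sphere where
  "infty \<equiv> None"

abbreviation sphere_topology :: "sphere topology" where
  "sphere_topology \<equiv> Alexandroff_compactification (euclidean :: complex topology)"

abbreviation sphere2_topology :: "(sphere \<times> sphere) topology" where
  "sphere2_topology \<equiv> prod_topology sphere_topology sphere_topology"

text \<open>Note the convention that zero times infinity is \<^emph>\<open>one\<close>.\<close>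

fun sphere_mult :: "sphere \<Rightarrow> sphere \<Rightarrow> sphere" where
  "sphere_mult (Some z) (Some w) = Some (z * w)"
| "sphere_mult None None = infty"
| "sphere_mult (Some z) None = (if z = 0 then Some 1 else infty)"
| "sphere_mult None (Some w) = (if w = 0 then Some 1 else infty)"

text \<open>The map \<open>z \<mapsto> 1/z\<close>, exchanging zero and infinity.\<close>

fun sphere_inverse :: "sphere \<Rightarrow> sphere" where
  "sphere_inverse None = Some 0"
| "sphere_inverse (Some z) = (if z = 0 then infty else Some (1 / z))"

text \<open>The map \<open>z \<mapsto> (a z + b) / (c z + d)\<close>, of interest when \<open>a d - b c \<noteq> 0\<close>.\<close>

fun sphere_moebius :: "complex \<Rightarrow> complex \<Rightarrow> complex \<Rightarrow> complex \<Rightarrow> sphere \<Rightarrow> sphere" where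
  "sphere_moebius a b c d None = (if c = 0 then infty else Some (a / c))"
| "sphere_moebius a b c d (Some z) =
     (if c * z + d = 0 then infty else Some (moebius a b c d z))"

definition Aut_sphere :: "(sphere \<Rightarrow> sphere) set" where
  "Aut_sphere = {sphere_moebius a b c d | a b c d. a * d - b * c \<noteq> 0}"

section \<open>The complex manifold \<open>\<Omega>\<close>\<close>

definition Omega :: "(sphere \<times> sphere) set" where
  "Omega = {(z, w). sphere_mult z w \<noteq> Some 1}"

definition Omega_topology :: "(sphere \<times> sphere) topology" where
  "Omega_topology = subtopology sphere2_topology Omega"

definition subdomain :: "(sphere \<times> sphere) set \<Rightarrow> bool" where
  "subdomain U \<longleftrightarrow> U \<noteq> {} \<and> openin Omega_topology U \<and> connectedin Omega_topology U"

datatype chart = Plus | Minus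

fun chart_domain :: "chart \<Rightarrow> (sphere \<times> sphere) set" where
  "chart_domain Plus = Omega \<inter> (- {infty}) \<times> (- {infty})"
| "chart_domain Minus = Omega \<inter> (- {Some 0}) \<times> (- {Some 0})"

fun chart_map :: "chart \<Rightarrow> sphere \<times> sphere \<Rightarrow> complex \<times> complex" where
  "chart_map Plus (u, v) = (the u, the v)"
| "chart_map Minus (u, v) = (the (sphere_inverse v), the (sphere_inverse u))"

definition chart_inv :: "chart \<Rightarrow> complex \<times> complex \<Rightarrow> sphere \<times> sphere" where
  "chart_inv c = inv_into (chart_domain c) (chart_map c)"

section \<open>Holomorphic functions and mappings\<close>

text \<open>Holomorphy in two complex variables on an open set: the real (Frechet) derivative exists
  and is complex linear at every point.\<close>

definition holomorphic2_on :: "(complex \<times> complex \<Rightarrow> complex) \<Rightarrow> (complex \<times> complex) set \<Rightarrow> bool" where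
  "holomorphic2_on f S \<longleftrightarrow>
     (\<forall>p\<in>S. \<exists>a b. (f has_derivative (\<lambda>(h, k). a * h + b * k)) (at p))"

definition holomorphic_functions :: "(sphere \<times> sphere) set \<Rightarrow> (sphere \<times> sphere \<Rightarrow> complex) set" where
  "holomorphic_functions U =
     {F. \<forall>c. holomorphic2_on (F \<circ> chart_inv c) (chart_map c ` (U \<inter> chart_domain c))}"

text \<open>Mappings are total functions; only their values on the open set \<open>U\<close> are relevant.\<close>

definition holomorphic_mapping :: "(sphere \<times> sphere) set \<Rightarrow> (sphere \<times> sphere \<Rightarrow> sphere \<times> sphere) \<Rightarrow> bool" where
  "holomorphic_mapping U T \<longleftrightarrow>
     continuous_map (subtopology Omega_topology U) Omega_topology T \<and>
     (\<forall>c d. let S = chart_map c ` (U \<inter> chart_domain c \<inter> T -` chart_domain d);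
                G = chart_map d \<circ> T \<circ> chart_inv c
            in holomorphic2_on (fst \<circ> G) S \<and> holomorphic2_on (snd \<circ> G) S)"

definition biholomorphic_self_map :: "(sphere \<times> sphere \<Rightarrow> sphere \<times> sphere) \<Rightarrow> bool" where
  "biholomorphic_self_map S \<longleftrightarrow>
     bij_betw S Omega Omega \<and> holomorphic_mapping Omega S \<and>
     holomorphic_mapping Omega (inv_into Omega S)"

section \<open>The Laplacian and the group \<open>\<M>\<close>\<close>

definition chart_laplacian :: "chart \<Rightarrow> (sphere \<times> sphere \<Rightarrow> complex) \<Rightarrow> sphere \<times> sphere \<Rightarrow> complex" where
  "chart_laplacian c F p =
     (case chart_map c p of (z, w) \<Rightarrow>
        4 * (1 - z * w)\<^sup>2 * deriv (\<lambda>x. deriv (\<lambda>y. F (chart_inv c (x, y))) w) z)"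

text \<open>For \<open>F\<close> holomorphic near \<open>p\<close>, the two charts give the same value where both are defined:
  with \<open>z = 1/v\<close> and \<open>w = 1/u\<close> one has
  \<open>\<partial>\<^sub>z \<partial>\<^sub>w = u\<^sup>2 v\<^sup>2 \<partial>\<^sub>v \<partial>\<^sub>u\<close> and \<open>(1 - z w)\<^sup>2 u\<^sup>2 v\<^sup>2 = (1 - u v)\<^sup>2\<close>.
  So it does not matter which one is preferred on the overlap.\<close>

definition laplacian :: "(sphere \<times> sphere \<Rightarrow> complex) \<Rightarrow> sphere \<times> sphere \<Rightarrow> complex" where
  "laplacian F p =
     (if p \<in> chart_domain Plus then chart_laplacian Plus F p else chart_laplacian Minus F p)"

definition moebius_group :: "(sphere \<times> sphere \<Rightarrow> sphere \<times> sphere) set" where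
  "moebius_group =
     {S. biholomorphic_self_map S \<and>
         (\<exists>\<psi>\<in>Aut_sphere.
            (\<forall>(z, w)\<in>Omega. S (z, w) = (\<psi> z, sphere_inverse (\<psi> (sphere_inverse w)))) \<or>
            (\<forall>(z, w)\<in>Omega. S (z, w) = (\<psi> w, sphere_inverse (\<psi> (sphere_inverse z)))))}"

end

theory Submission
  imports Defs "HOL-Complex_Analysis.Cauchy_Integral_Formula"
begin

text \<open>The Laplacian is a second-order operator whose principal symbol is dual to the complex
  metric \<open>dz dw / (1 - z w)\<^sup>2\<close>.  The theorem says that preserving the operator is as rigid as preserving
  this metric, and that the only local isometries are restrictions of the global maps built from one
  Moebius transformation.

  From invariance to the group.  Let \<open>(a, b)\<close> be \<open>T\<close> in coordinates.  Applied to a product \<open>X Y\<close> of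
  two functions that vanish at \<open>T p\<close>, the operator sees only first derivatives of \<open>X\<close> and \<open>Y\<close>
  (\<open>mixed_mult_vanishing\<close>).  There are enough global holomorphic functions on \<open>\<Omega>\<close> to take for \<open>X\<close>
  and \<open>Y\<close> the coordinate functions centred at \<open>T p\<close>, divided by \<open>1 - z w\<close>
  (\<open>test_function_exists\<close>), and invariance becomes (\<open>conformal_equations\<close>)
  \<open>a\<^sub>z a\<^sub>w = 0\<close>, \<open>b\<^sub>z b\<^sub>w = 0\<close>, \<open>(1 - z w)\<^sup>2 (a\<^sub>z b\<^sub>w + a\<^sub>w b\<^sub>z) = (1 - a b)\<^sup>2\<close>.
  The right-hand side never vanishes, so at each point either \<open>a\<close> depends to first order only on \<open>z\<close>
  and \<open>b\<close> only on \<open>w\<close>, or the other way round, and on a bidisc one of the two alternatives holds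
  throughout.  In the first case \<open>(1 - z w)\<^sup>2 a'(z) b'(w) = (1 - a(z) b(w))\<^sup>2\<close>.  Differentiating this
  once in \<open>w\<close> and eliminating \<open>a'(z)\<close> leaves an equation that is linear in \<open>a(z)\<close> with
  coefficients linear in \<open>z\<close>, so \<open>a\<close> is a Moebius transformation \<open>\<psi>\<close>; differentiating in \<open>z\<close> then
  forces \<open>b(w) = 1 / \<psi>(1/w)\<close> (\<open>separated_isometry\<close>).  Thus \<open>T\<close> agrees locally with elements of the
  group.  Two elements that agree near one point are equal (\<open>isometries_eqI\<close>), so on the connected
  set \<open>U\<close> a single element serves everywhere.

  From the group to invariance.  For \<open>g = \<psi>\<close> and \<open>h(w) = 1 / \<psi>(1/w)\<close> the equation
  \<open>(1 - z w)\<^sup>2 g'(z) h'(w) = (1 - g(z) h(w))\<^sup>2\<close> holds by direct computation, and this is the chain rule for the Laplacian (\<open>mixed_moebius\<close>); exchanging the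
  variables is harmless because mixed derivatives commute (\<open>mixed_swap\<close>).

  Two charts.  The second chart is the first one composed with
  \<open>(z, w) \<mapsto> (1/w, 1/z)\<close>, an involution that itself belongs to the group and commutes with it.
  So a group element read in any pair of charts is again a group element read in the first chart,
  and no computation has to be repeated at infinity.\<close>

section \<open>Holomorphy in two complex variables\<close>

text \<open>Holomorphy at a single point, which makes closure under composition and arithmetic pointwise.\<close>

definition hol2_at :: "(complex \<times> complex \<Rightarrow> complex) \<Rightarrow> complex \<times> complex \<Rightarrow> bool" where
  "hol2_at f p \<longleftrightarrow> (\<exists>a b. (f has_derivative (\<lambda>(h, k). a * h + b * k)) (at p))"

lemma holomorphic2_on_iff: "holomorphic2_on f S \<longleftrightarrow> (\<forall>p\<in>S. hol2_at f p)"
  by (simp add: holomorphic2_on_def hol2_at_def)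

definition dz :: "(complex \<times> complex \<Rightarrow> complex) \<Rightarrow> complex \<Rightarrow> complex \<Rightarrow> complex" where
  "dz f z w = deriv (\<lambda>x. f (x, w)) z"

definition dw :: "(complex \<times> complex \<Rightarrow> complex) \<Rightarrow> complex \<Rightarrow> complex \<Rightarrow> complex" where
  "dw f z w = deriv (\<lambda>y. f (z, y)) w"

text \<open>The inner derivative is taken in the second variable, as in the Laplacian; that the order is
  immaterial is the content of \<open>mixed_derivative\<close> below.\<close>

definition mixed :: "(complex \<times> complex \<Rightarrow> complex) \<Rightarrow> complex \<Rightarrow> complex \<Rightarrow> complex" where
  "mixed f z w = deriv (\<lambda>x. deriv (\<lambda>y. f (x, y)) w) z"

lemma slice_z:
  assumes "(f has_derivative (\<lambda>(h, k). a * h + b * k)) (at (z, w))"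
  shows "((\<lambda>x. f (x, w)) has_field_derivative a) (at z)"
proof -
  have "((\<lambda>x. (x, w)) has_derivative (\<lambda>h. (h, 0))) (at z)"
    by (auto intro!: derivative_eq_intros)
  from has_derivative_compose[OF this, of f "\<lambda>(h, k). a * h + b * k"] assms
  show ?thesis by (simp add: has_field_derivative_def)
qed

lemma slice_w:
  assumes "(f has_derivative (\<lambda>(h, k). a * h + b * k)) (at (z, w))"
  shows "((\<lambda>y. f (z, y)) has_field_derivative b) (at w)"
proof -
  have "((\<lambda>y. (z, y)) has_derivative (\<lambda>h. (0, h))) (at w)"
    by (auto intro!: derivative_eq_intros)
  from has_derivative_compose[OF this, of f "\<lambda>(h, k). a * h + b * k"] assms
  show ?thesis by (simp add: has_field_derivative_def)
qed

lemma hol2_at_derivative: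
  assumes "hol2_at f (z, w)"
  shows "(f has_derivative (\<lambda>(h, k). dz f z w * h + dw f z w * k)) (at (z, w))"
    and "((\<lambda>x. f (x, w)) has_field_derivative dz f z w) (at z)"
    and "((\<lambda>y. f (z, y)) has_field_derivative dw f z w) (at w)"
proof -
  obtain a b where ab: "(f has_derivative (\<lambda>(h, k). a * h + b * k)) (at (z, w))"
    using assms by (auto simp: hol2_at_def)
  have "dz f z w = a" "dw f z w = b"
    using slice_z[OF ab] slice_w[OF ab] by (auto simp: dz_def dw_def DERIV_imp_deriv)
  with ab slice_z[OF ab] slice_w[OF ab]
  show "(f has_derivative (\<lambda>(h, k). dz f z w * h + dw f z w * k)) (at (z, w))"
    "((\<lambda>x. f (x, w)) has_field_derivative dz f z w) (at z)"
    "((\<lambda>y. f (z, y)) has_field_derivative dw f z w) (at w)" by auto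
qed

lemma hol2_at_isCont: "hol2_at f p \<Longrightarrow> isCont f p"
  unfolding hol2_at_def by (metis has_derivative_continuous)

lemma hol2_at_chain:
  assumes f: "hol2_at f (a p, b p)" and a: "hol2_at a p" and b: "hol2_at b p"
  shows "hol2_at (\<lambda>q. f (a q, b q)) p"
proof -
  obtain f1 f2 a1 a2 b1 b2 where
    F: "(f has_derivative (\<lambda>(h, k). f1 * h + f2 * k)) (at (a p, b p))" and
    A: "(a has_derivative (\<lambda>(h, k). a1 * h + a2 * k)) (at p)" and
    B: "(b has_derivative (\<lambda>(h, k). b1 * h + b2 * k)) (at p)"
    using assms unfolding hol2_at_def by blast
  have "((\<lambda>q. (a q, b q)) has_derivative
        (\<lambda>v. ((\<lambda>(h, k). a1 * h + a2 * k) v, (\<lambda>(h, k). b1 * h + b2 * k) v))) (at p)"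
    by (rule has_derivative_Pair[OF A B])
  from has_derivative_compose[OF this F]
  have "((\<lambda>q. f (a q, b q)) has_derivative
         (\<lambda>(h, k). (f1 * a1 + f2 * b1) * h + (f1 * a2 + f2 * b2) * k)) (at p)"
    by (rule has_derivative_eq_rhs) (auto simp: algebra_simps fun_eq_iff)
  then show ?thesis unfolding hol2_at_def by blast
qed

lemma hol2_at_linear: "hol2_at (\<lambda>q. a * fst q + b * snd q + c) p"
  unfolding hol2_at_def
  by (rule exI[of _ a], rule exI[of _ b])
     (auto intro!: derivative_eq_intros simp: fun_eq_iff)

lemma hol2_at_basic [simp]:
  "hol2_at fst p" "hol2_at snd p" "hol2_at (\<lambda>q. c) p"
  using hol2_at_linear[of 1 0 0 p] hol2_at_linear[of 0 1 0 p] hol2_at_linear[of 0 0 c p]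
  by simp_all

lemma hol2_at_add: "hol2_at f p \<Longrightarrow> hol2_at g p \<Longrightarrow> hol2_at (\<lambda>q. f q + g q) p"
  using hol2_at_chain[where f = "\<lambda>q. fst q + snd q" and a = f and b = g and p = p]
    hol2_at_linear[of 1 1 0] by simp

lemma hol2_at_diff: "hol2_at f p \<Longrightarrow> hol2_at g p \<Longrightarrow> hol2_at (\<lambda>q. f q - g q) p"
  using hol2_at_chain[where f = "\<lambda>q. fst q - snd q" and a = f and b = g and p = p]
    hol2_at_linear[of 1 "-1" 0] by simp

lemma hol2_at_mult:
  assumes "hol2_at f p" "hol2_at g p"
  shows "hol2_at (\<lambda>q. f q * g q) p"
proof -
  have "hol2_at (\<lambda>q. fst q * snd q) x" for x :: "complex \<times> complex"
    unfolding hol2_at_def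
    by (rule exI[of _ "snd x"], rule exI[of _ "fst x"])
       (auto intro!: derivative_eq_intros simp: fun_eq_iff)
  from hol2_at_chain[OF this assms] show ?thesis by simp
qed

lemma hol2_at_divide:
  assumes "hol2_at f p" "hol2_at g p" "g p \<noteq> 0"
  shows "hol2_at (\<lambda>q. f q / g q) p"
proof -
  have "hol2_at (\<lambda>q. fst q / snd q) (f p, g p)"
    unfolding hol2_at_def using assms(3)
    by (intro exI[of _ "1 / g p"] exI[of _ "- f p / (g p)\<^sup>2"])
       (auto intro!: derivative_eq_intros simp: fun_eq_iff field_simps power2_eq_square)
  from hol2_at_chain[OF this assms(1,2)] show ?thesis by simp
qed

lemmas hol2_at_intros = hol2_at_basic hol2_at_add hol2_at_diff hol2_at_mult hol2_at_divide

lemma hol2_at_cong: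
  assumes "hol2_at f p" "open S" "p \<in> S" "\<And>x. x \<in> S \<Longrightarrow> f x = g x"
  shows "hol2_at g p"
  using assms unfolding hol2_at_def
  by (metis has_derivative_transform_within_open)

section \<open>The mixed second derivative\<close>

lemma open_contains_polydisc:
  fixes S :: "(complex \<times> complex) set"
  assumes "open S" "(z, w) \<in> S"
  obtains r where "r > 0" "ball z r \<times> ball w r \<subseteq> S"
proof -
  obtain e where e: "e > 0" "ball (z, w) e \<subseteq> S"
    using assms openE by blast
  have "ball z (e / 2) \<times> ball w (e / 2) \<subseteq> ball (z, w) e"
  proof clarsimp
    fix x y assume "dist z x * 2 < e" "dist w y * 2 < e"
    moreover have "dist (z, w) (x, y) \<le> dist z x + dist w y"
      by (simp add: dist_Pair_Pair sqrt_sum_squares_le_sum)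
    ultimately show "dist (z, w) (x, y) < e" by simp
  qed
  with e that[of "e / 2"] show ?thesis by auto
qed

lemma slice_eventually:
  fixes S :: "(complex \<times> complex) set"
  assumes "open S" "(z, w) \<in> S"
  shows "\<forall>\<^sub>F x in nhds z. (x, w) \<in> S" "\<forall>\<^sub>F y in nhds w. (z, y) \<in> S"
proof -
  obtain r where r: "r > 0" "ball z r \<times> ball w r \<subseteq> S" using open_contains_polydisc assms by blast
  then have "\<And>x. x \<in> ball z r \<Longrightarrow> (x, w) \<in> S" "\<And>y. y \<in> ball w r \<Longrightarrow> (z, y) \<in> S"
    by auto
  with r(1) show "\<forall>\<^sub>F x in nhds z. (x, w) \<in> S" "\<forall>\<^sub>F y in nhds w. (z, y) \<in> S"
    by (meson centre_in_ball eventually_nhds open_ball)+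
qed

lemma mixed_cong:
  assumes "open S" "(z, w) \<in> S" "\<And>q. q \<in> S \<Longrightarrow> f q = g q"
  shows "mixed f z w = mixed g z w"
proof -
  have "deriv (\<lambda>y. f (x, y)) w = deriv (\<lambda>y. g (x, y)) w" if "(x, w) \<in> S" for x
  proof (rule deriv_cong_ev)
    show "\<forall>\<^sub>F y in nhds w. f (x, y) = g (x, y)"
      using slice_eventually(2)[OF assms(1) that] by eventually_elim (use assms in auto)
  qed auto
  then have "\<forall>\<^sub>F x in nhds z. deriv (\<lambda>y. f (x, y)) w = deriv (\<lambda>y. g (x, y)) w"
    by (rule eventually_mono[OF slice_eventually(1)[OF assms(1,2)]])
  then show ?thesis unfolding mixed_def by (rule deriv_cong_ev) auto
qed

text \<open>Frechet differentiability alone does not make \<open>f\<^sub>w\<close> differentiable in \<open>z\<close>.  The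
  reason is that \<open>f\<^sub>w\<close> is a locally uniform limit of difference quotients in \<open>w\<close>, which are
  holomorphic in \<open>z\<close>; Weierstrass' theorem then gives the derivative of the limit and also shows that
  it is the limit of the differentiated quotients.  The second fact is kept because it identifies the
  derivative with \<open>\<partial>\<^sub>w f\<^sub>z\<close>.\<close>

lemma dw_holomorphic_in_z:
  assumes S: "open S" "(z, w) \<in> S" and f: "\<And>p. p \<in> S \<Longrightarrow> hol2_at f p"
  shows "\<exists>m t. ((\<lambda>x. dw f x w) has_field_derivative m) (at z) \<and>
     (\<forall>n. t n \<noteq> 0) \<and> t \<longlonglongrightarrow> 0 \<and>
     (\<lambda>n. (dz f z (w + t n) - dz f z w) / t n) \<longlonglongrightarrow> m"
proof -
  obtain r where r: "r > 0" "ball z r \<times> ball w r \<subseteq> S" using open_contains_polydisc S by blast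
  \<comment> \<open>Room for discs of radius \<open>s\<close> around every point of a disc of radius \<open>s\<close>, inside the bidisc.\<close>
  define s where "s = r / 4"
  have s: "s > 0" "cball z (2 * s) \<times> cball w (2 * s) \<subseteq> S"
    using r by (auto simp: s_def subset_iff)
  have "continuous_on (cball z (2 * s) \<times> cball w (2 * s)) f"
    using s(2) f hol2_at_isCont by (intro continuous_at_imp_continuous_on) blast
  then have "compact (f ` (cball z (2 * s) \<times> cball w (2 * s)))"
    by (intro compact_continuous_image compact_Times compact_cball)
  then have "bounded (f ` (cball z (2 * s) \<times> cball w (2 * s)))" by (rule compact_imp_bounded)
  then obtain B where B: "\<And>q. q \<in> cball z (2 * s) \<times> cball w (2 * s) \<Longrightarrow> norm (f q) \<le> B"
    unfolding bounded_iff by blast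
  have fw: "((\<lambda>y. f (x, y)) has_field_derivative dw f x y) (at y)"
    and fz: "((\<lambda>x. f (x, y)) has_field_derivative dz f x y) (at x)"
    if "x \<in> cball z (2 * s)" "y \<in> cball w (2 * s)" for x y
  proof -
    have "(x, y) \<in> S" using that s(2) by blast
    from hol2_at_derivative[OF f[OF this]]
    show "((\<lambda>y. f (x, y)) has_field_derivative dw f x y) (at y)"
      "((\<lambda>x. f (x, y)) has_field_derivative dz f x y) (at x)" by auto
  qed
  define K where "K = 2 * B / s\<^sup>2"
  \<comment> \<open>Cauchy's estimate bounds the second derivative in the second variable uniformly in the first.\<close>
  have K: "norm ((deriv ^^ 2) (\<lambda>y. f (x, y)) y) \<le> K"
    if x: "x \<in> cball z s" and y: "y \<in> cball w s" for x y
  proof -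
    have sub: "cball y s \<subseteq> cball w (2 * s)"
      using y by (auto simp: cball_subset_cball_iff dist_commute)
    have x': "x \<in> cball z (2 * s)" using x s(1) by auto
    have D: "(\<lambda>y. f (x, y)) field_differentiable (at v)" if "v \<in> cball y s" for v
      using fw[OF x'] sub that unfolding field_differentiable_def by blast
    have "norm ((deriv ^^ 2) (\<lambda>y. f (x, y)) y) \<le> fact 2 * B / s^2"
    proof (rule Cauchy_inequality)
      show "(\<lambda>y. f (x, y)) holomorphic_on ball y s"
        unfolding holomorphic_on_def
        using D field_differentiable_at_within ball_subset_cball by blast
      show "continuous_on (cball y s) (\<lambda>y. f (x, y))"
        using D field_differentiable_imp_continuous_at
      by (intro continuous_at_imp_continuous_on) blast
      show "norm (f (x, v)) \<le> B" if "norm (y - v) = s" for v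
        using B[of "(x, v)"] x' sub that by (auto simp: dist_norm subset_iff)
    qed (use s in auto)
    then show ?thesis by (simp add: K_def fact_numeral)
  qed
  have Taylor: "norm (f (x, y) - f (x, w) - dw f x w * (y - w)) \<le> K * norm (y - w)^2"
    if x: "x \<in> cball z s" and y: "y \<in> cball w s" for x y
  proof -
    let ?g = "\<lambda>y. f (x, y)"
    have x': "x \<in> cball z (2 * s)" using x s(1) by auto
    have hol: "?g holomorphic_on ball w (2 * s)"
      unfolding holomorphic_on_def field_differentiable_def
      using fw[OF x'] has_field_derivative_at_within ball_subset_cball by blast
    have "norm ((deriv ^^ 0) ?g y - (\<Sum>i\<le>1. (deriv ^^ i) ?g w * (y - w)^i / fact i))
        \<le> K * norm (y - w)^(Suc 1) / fact 1"
    proof (rule complex_Taylor[where S = "cball w s" and f = "\<lambda>i. (deriv ^^ i) ?g"])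
      fix i v assume "v \<in> cball w s" "i \<le> (1::nat)"
      then have v: "v \<in> ball w (2 * s)" using s(1) by auto
      have "((deriv ^^ i) ?g has_field_derivative deriv ((deriv ^^ i) ?g) v) (at v)"
        by (rule holomorphic_derivI[OF holomorphic_higher_deriv[OF hol] _ v]) auto
      then show "((deriv ^^ i) ?g has_field_derivative (deriv ^^ Suc i) ?g v) (at v within cball w s)"
        by (simp add: has_field_derivative_at_within)
    next
      fix v assume "v \<in> cball w s"
      then show "norm ((deriv ^^ Suc 1) ?g v) \<le> K" using K[OF x, of v]
        by (simp add: numeral_2_eq_2)
    qed (use y s in auto)
    then show ?thesis by (simp add: dw_def power2_eq_square algebra_simps)
  qed
  have K0: "K \<ge> 0" using order_trans[OF norm_ge_zero K[of z w]] s(1) by simp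
  define t where "t n = complex_of_real (s / real (Suc n))" for n
  have t0: "t n \<noteq> 0" for n using s(1) unfolding t_def of_real_eq_0_iff by simp
  have nt: "norm (t n) = s / real (Suc n)" for n using s(1) unfolding t_def norm_of_real by simp
  have tlim: "t \<longlonglongrightarrow> 0"
  proof -
    have "(\<lambda>n. s / real (Suc n)) \<longlonglongrightarrow> 0"
      using LIMSEQ_inverse_real_of_nat[THEN tendsto_mult_left, of s] by (simp add: field_simps)
    then show ?thesis unfolding t_def by (metis of_real_0 tendsto_of_real)
  qed
  have tin: "w + t n \<in> cball w s" for n
    unfolding mem_cball dist_norm using nt[of n] s(1) divide_left_mono[of 1 "real (Suc n)" s] by simp
  define F where "F n x = (f (x, w + t n) - f (x, w)) / t n" for n x
  have est: "norm (F n x - dw f x w) \<le> K * norm (t n)" if "x \<in> cball z s" for n x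
  proof -
    have "F n x - dw f x w = (f (x, w + t n) - f (x, w) - dw f x w * t n) / t n"
      using t0[of n] by (simp add: F_def field_simps)
    also have "norm \<dots> \<le> K * norm (t n)^2 / norm (t n)"
      using Taylor[OF that tin[of n]] by (simp add: norm_divide divide_right_mono)
    also have "\<dots> = K * norm (t n)" using t0[of n] by (simp add: power2_eq_square)
    finally show ?thesis .
  qed
  have ul: "uniform_limit (cball z s) F (\<lambda>x. dw f x w) sequentially"
  proof (rule uniform_limitI)
    fix e :: real assume e: "e > 0"
    have "(\<lambda>n. K * norm (t n)) \<longlonglongrightarrow> 0"
      using tendsto_mult_left[OF tendsto_norm_zero[OF tlim], of K] by simp
    then have "\<forall>\<^sub>F n in sequentially. K * norm (t n) < e"
      using e by (rule order_tendstoD)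
    then show "\<forall>\<^sub>F n in sequentially. \<forall>x\<in>cball z s. dist (F n x) (dw f x w) < e"
    proof eventually_elim
      case (elim n)
      show ?case
      proof
        fix x assume "x \<in> cball z s"
        from est[OF this, of n] elim show "dist (F n x) (dw f x w) < e"
          by (simp add: dist_norm)
      qed
    qed
  qed
  have "\<exists>g'. \<forall>x\<in>ball z s. ((\<lambda>x. dw f x w) has_field_derivative g' x) (at x) \<and>
           (\<lambda>n. (dz f x (w + t n) - dz f x w) / t n) \<longlonglongrightarrow> g' x"
  proof (rule has_complex_derivative_uniform_sequence[where f = F])
    fix n x assume "x \<in> ball z s"
    then have x: "x \<in> cball z (2 * s)" using s(1) by auto
    have y: "w + t n \<in> cball w (2 * s)" "w \<in> cball w (2 * s)" using tin[of n] s(1) by auto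
    show "(F n has_field_derivative (dz f x (w + t n) - dz f x w) / t n) (at x)"
      unfolding F_def using fz[OF x y(1)] fz[OF x y(2)] by (intro DERIV_cdivide DERIV_diff)
  next
    fix x assume x: "x \<in> ball z s"
    then obtain d where d: "d > 0" "cball x d \<subseteq> ball z s"
      by (meson open_ball open_contains_cball)
    then have "uniform_limit (cball x d) F (\<lambda>x. dw f x w) sequentially"
      using uniform_limit_on_subset[OF ul] ball_subset_cball by (meson order_trans)
    with d show "\<exists>d>0. cball x d \<subseteq> ball z s \<and> uniform_limit (cball x d) F (\<lambda>x. dw f x w) sequentially"
      by blast
  qed auto
  then obtain g' where "((\<lambda>x. dw f x w) has_field_derivative g' z) (at z)"
       "(\<lambda>n. (dz f z (w + t n) - dz f z w) / t n) \<longlonglongrightarrow> g' z"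
    using s(1) by (meson centre_in_ball)
  with t0 tlim show ?thesis by blast
qed

lemma hol2_at_swap:
  assumes "hol2_at f (z, w)" shows "hol2_at (\<lambda>q. f (snd q, fst q)) (w, z)"
  using hol2_at_chain[where f = f and a = snd and b = fst and p = "(w, z)"] assms by simp

lemma open_swap:
  fixes S :: "('a :: topological_space \<times> 'b :: topological_space) set"
  assumes "open S" shows "open ((\<lambda>q. (snd q, fst q)) -` S)"
  using assms by (intro open_vimage) (auto intro!: continuous_intros)

text \<open>Both orders of differentiation exist by the previous lemma and its mirror image, and
  they agree because one sequence of quotients converges to both.\<close>

lemma mixed_derivative:
  assumes S: "open S" "(z, w) \<in> S" and f: "\<And>p. p \<in> S \<Longrightarrow> hol2_at f p"
  shows "((\<lambda>x. dw f x w) has_field_derivative mixed f z w) (at z)"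
    and "((\<lambda>y. dz f z y) has_field_derivative mixed f z w) (at w)"
proof -
  obtain m t where m: "((\<lambda>x. dw f x w) has_field_derivative m) (at z)"
     and t: "\<And>n. t n \<noteq> 0" "t \<longlonglongrightarrow> 0"
     and lim: "(\<lambda>n. (dz f z (w + t n) - dz f z w) / t n) \<longlonglongrightarrow> m"
    using dw_holomorphic_in_z[OF assms] by blast
  let ?f = "\<lambda>q. f (snd q, fst q)"
  have sw: "dw ?f = (\<lambda>x y. dz f y x)" by (simp add: dw_def dz_def fun_eq_iff)
  have "hol2_at ?f p" if "p \<in> (\<lambda>q. (snd q, fst q)) -` S" for p
    using hol2_at_swap[of f "snd p" "fst p"] f that by simp
  then have "\<exists>m'. ((\<lambda>x. dw ?f x z) has_field_derivative m') (at w)"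
    using dw_holomorphic_in_z[OF open_swap[OF S(1)], of w z ?f] S(2) by auto
  then obtain m' where m': "((\<lambda>y. dz f z y) has_field_derivative m') (at w)"
    unfolding sw by blast
  have "(\<lambda>n. (dz f z (w + t n) - dz f z w) / t n) \<longlonglongrightarrow> m'"
    using filterlim_compose[OF m'[unfolded DERIV_def] filterlim_atI[OF t(2)]] t(1) by simp
  then have "m' = m" using lim LIMSEQ_unique by blast
  moreover have "mixed f z w = m"
    using m by (simp add: mixed_def dw_def DERIV_imp_deriv)
  ultimately show "((\<lambda>x. dw f x w) has_field_derivative mixed f z w) (at z)"
    "((\<lambda>y. dz f z y) has_field_derivative mixed f z w) (at w)" using m m' by auto
qed

lemma mixed_swap:
  assumes "open S" "(w, z) \<in> S" "\<And>p. p \<in> S \<Longrightarrow> hol2_at f p"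
  shows "mixed (\<lambda>q. f (snd q, fst q)) z w = mixed f w z"
  using mixed_derivative(2)[OF assms] by (simp add: mixed_def dz_def DERIV_imp_deriv)

lemma mixed_product_map:
  assumes S: "open S" "(g z, h w) \<in> S" and f: "\<And>p. p \<in> S \<Longrightarrow> hol2_at f p"
    and g: "(g has_field_derivative g') (at z)" and h: "(h has_field_derivative h') (at w)"
  shows "mixed (\<lambda>q. f (g (fst q), h (snd q))) z w = mixed f (g z) (h w) * g' * h'"
proof -
  have "isCont g z" using g DERIV_isCont by blast
  then have "\<forall>\<^sub>F x in nhds z. (g x, h w) \<in> S"
    by (intro eventually_compose_filterlim[OF slice_eventually(1)[OF S]])
       (simp add: isCont_def tendsto_at_iff_tendsto_nhds)
  then have ev: "\<forall>\<^sub>F x in nhds z. deriv (\<lambda>y. f (g x, h y)) w = dw f (g x) (h w) * h'"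
  proof eventually_elim
    case (elim x)
    from DERIV_chain2[OF hol2_at_derivative(3)[OF f[OF elim]] h]
    show ?case by (rule DERIV_imp_deriv)
  qed
  have "mixed (\<lambda>q. f (g (fst q), h (snd q))) z w = deriv (\<lambda>x. dw f (g x) (h w) * h') z"
    unfolding mixed_def using ev by (intro deriv_cong_ev) auto
  also have "\<dots> = mixed f (g z) (h w) * g' * h'"
    by (rule DERIV_imp_deriv, rule DERIV_cmult_right,
        rule DERIV_chain2[OF mixed_derivative(1)[OF S f] g])
  finally show ?thesis .
qed

text \<open>Every term containing a second derivative carries a factor \<open>X\<close> or \<open>Y\<close> and disappears.
  This isolates the principal symbol of the Laplacian.\<close>

lemma mixed_mult_vanishing:
  assumes S: "open S" "(z, w) \<in> S"
    and f: "\<And>p. p \<in> S \<Longrightarrow> hol2_at X p" "\<And>p. p \<in> S \<Longrightarrow> hol2_at Y p" "\<And>p. p \<in> S \<Longrightarrow> hol2_at k p"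
    and van: "X (z, w) = 0" "Y (z, w) = 0"
  shows "mixed (\<lambda>p. X p * Y p * k p) z w
    = (dz X z w * dw Y z w + dw X z w * dz Y z w) * k (z, w)"
proof -
  have "\<forall>\<^sub>F x in nhds z. deriv (\<lambda>y. X (x, y) * Y (x, y) * k (x, y)) w =
       (dw X x w * Y (x, w) + dw Y x w * X (x, w)) * k (x, w) + dw k x w * (X (x, w) * Y (x, w))"
    using slice_eventually(1)[OF S]
  proof eventually_elim
    case (elim x)
    show ?case
      by (rule DERIV_imp_deriv, intro DERIV_mult hol2_at_derivative(3) f elim)
  qed
  then have "mixed (\<lambda>p. X p * Y p * k p) z w =
      deriv (\<lambda>x. (dw X x w * Y (x, w) + dw Y x w * X (x, w)) * k (x, w)
          + dw k x w * (X (x, w) * Y (x, w))) z"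
    unfolding mixed_def by (intro deriv_cong_ev) auto
  also have "\<dots> = (dz X z w * dw Y z w + dw X z w * dz Y z w) * k (z, w)"
  proof (rule DERIV_imp_deriv)
    note mX = mixed_derivative(1)[OF S f(1)] and mY = mixed_derivative(1)[OF S f(2)]
      and mk = mixed_derivative(1)[OF S f(3)]
      and dX = hol2_at_derivative(2)[OF f(1)[OF S(2)]] and dY = hol2_at_derivative(2)[OF f(2)[OF S(2)]]
      and dk = hol2_at_derivative(2)[OF f(3)[OF S(2)]]
    show "((\<lambda>x. (dw X x w * Y (x, w) + dw Y x w * X (x, w)) * k (x, w)
          + dw k x w * (X (x, w) * Y (x, w))) has_field_derivative
        (dz X z w * dw Y z w + dw X z w * dz Y z w) * k (z, w)) (at z)"
      using DERIV_add[OF DERIV_mult[OF DERIV_add[OF DERIV_mult[OF mX dY]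
              DERIV_mult[OF mY dX]] dk] DERIV_mult[OF mk DERIV_mult[OF dX dY]]]
      unfolding van by (simp add: algebra_simps)
  qed
  finally show ?thesis .
qed

text \<open>The maps \<open>g(z) = (A z + B) / (C z + D)\<close> and \<open>h(w) = (C + D w) / (A + B w) = 1 / g(1/w)\<close>
  satisfy \<open>1 - g h = \<Delta> (1 - z w) / (m n)\<close>, \<open>g' = \<Delta> / m\<^sup>2\<close> and \<open>h' = \<Delta> / n\<^sup>2\<close>, where \<open>\<Delta> = A D - B C\<close> and
  \<open>m\<close>, \<open>n\<close> are the denominators.  Hence \<open>(1 - z w)\<^sup>2 g' h' = (1 - g h)\<^sup>2\<close>.\<close>

lemma mixed_moebius:
  assumes S: "open S" "((A * z + B) / (C * z + D), (C + D * w) / (A + B * w)) \<in> S"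
    and f: "\<And>p. p \<in> S \<Longrightarrow> hol2_at f p"
    and ne: "C * z + D \<noteq> 0" "A + B * w \<noteq> 0"
  shows "(1 - z * w)\<^sup>2 * mixed (\<lambda>q. f ((A * fst q + B) / (C * fst q + D),
                                      (C + D * snd q) / (A + B * snd q))) z w
    = (1 - (A * z + B) / (C * z + D) * ((C + D * w) / (A + B * w)))\<^sup>2
        * mixed f ((A * z + B) / (C * z + D)) ((C + D * w) / (A + B * w))"
proof -
  define \<Delta> where "\<Delta> = A * D - B * C"
  define m n where "m = C * z + D" and "n = A + B * w"
  have g: "((\<lambda>z. (A * z + B) / (C * z + D)) has_field_derivative \<Delta> / m\<^sup>2) (at z)"
    using ne(1) unfolding m_def
    by (auto intro!: derivative_eq_intros simp: \<Delta>_def field_simps power2_eq_square)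
  have h: "((\<lambda>w. (C + D * w) / (A + B * w)) has_field_derivative \<Delta> / n\<^sup>2) (at w)"
    using ne(2) unfolding n_def
    by (auto intro!: derivative_eq_intros simp: \<Delta>_def field_simps power2_eq_square)
  have "1 - (A * z + B) / m * ((C + D * w) / n) = (m * n - (A * z + B) * (C + D * w)) / (m * n)"
    using ne unfolding m_def[symmetric] n_def[symmetric] by (simp add: diff_divide_distrib)
  also have "m * n - (A * z + B) * (C + D * w) = \<Delta> * (1 - z * w)"
    by (simp add: m_def n_def \<Delta>_def algebra_simps)
  finally have 1: "1 - (A * z + B) / m * ((C + D * w) / n) = \<Delta> * (1 - z * w) / (m * n)" .
  have 2: "mixed (\<lambda>q. f ((A * fst q + B) / (C * fst q + D), (C + D * snd q) / (A + B * snd q))) z w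
      = mixed f ((A * z + B) / (C * z + D)) ((C + D * w) / (A + B * w)) * (\<Delta> / m\<^sup>2) * (\<Delta> / n\<^sup>2)"
    by (rule mixed_product_map[OF S f g h])
  show ?thesis
    unfolding 2 m_def[symmetric] n_def[symmetric] 1
    by (simp add: power2_eq_square mult_ac)
qed

section \<open>The differential equations of an invariant map\<close>

text \<open>The weight \<open>1 / (1 - a b)\<^sup>2\<close> is the pull-back of the factor that
  makes the test functions extend holomorphically to all of \<open>\<Omega>\<close>.\<close>

lemma mixed_test_function:
  assumes S: "open S" "(z, w) \<in> S"
    and ab: "\<And>p. p \<in> S \<Longrightarrow> hol2_at a p" "\<And>p. p \<in> S \<Longrightarrow> hol2_at b p"
    and X: "\<And>p. p \<in> S \<Longrightarrow> hol2_at X p" "\<And>p. p \<in> S \<Longrightarrow> hol2_at Y p"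
    and ne: "\<And>p. p \<in> S \<Longrightarrow> a p * b p \<noteq> 1"
    and van: "X (z, w) = 0" "Y (z, w) = 0"
  shows "mixed (\<lambda>p. X p * Y p * (1 / (1 - a p * b p)\<^sup>2)) z w
    = (dz X z w * dw Y z w + dw X z w * dz Y z w) / (1 - a (z, w) * b (z, w))\<^sup>2"
proof -
  have "hol2_at (\<lambda>p. 1 / (1 - a p * b p)\<^sup>2) p" if "p \<in> S" for p
    unfolding power2_eq_square using ab[OF that] ne[OF that] by (intro hol2_at_intros) auto
  from mixed_mult_vanishing[where k = "\<lambda>p. 1 / (1 - a p * b p)\<^sup>2", OF S X this van]
  show ?thesis by simp
qed

lemma partial_minus_const:
  assumes "hol2_at a (z, w)"
  shows "dz (\<lambda>p. a p - c) z w = dz a z w" "dw (\<lambda>p. a p - c) z w = dw a z w"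
  unfolding dz_def dw_def
  using hol2_at_derivative(2,3)[OF assms]
  by (auto intro!: DERIV_imp_deriv derivative_eq_intros simp: DERIV_deriv_iff_field_differentiable
       simp: dz_def dw_def)

lemma partial_projections [simp]:
  "dz fst z w = 1" "dw fst z w = 0" "dz snd z w = 0" "dw snd z w = 1"
  by (simp_all add: dz_def dw_def)

text \<open>The three equations come from the squares and the product of the centred coordinates
  \<open>u - a(z, w)\<close> and \<open>v - b(z, w)\<close> on the target: there their symbols are \<open>0\<close>, \<open>0\<close> and \<open>1\<close>, up to the
  common weight.\<close>

lemma conformal_equations:
  fixes a b :: "complex \<times> complex \<Rightarrow> complex"
  assumes S: "open S" "(z, w) \<in> S"
    and ab: "\<And>p. p \<in> S \<Longrightarrow> hol2_at a p" "\<And>p. p \<in> S \<Longrightarrow> hol2_at b p"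
    and ne: "\<And>p. p \<in> S \<Longrightarrow> a p * b p \<noteq> 1" and zw: "z * w \<noteq> 1"
    and inv: "\<And>l m. l \<in> {\<lambda>q. fst q - a (z, w), \<lambda>q. snd q - b (z, w)} \<Longrightarrow>
         m \<in> {\<lambda>q. fst q - a (z, w), \<lambda>q. snd q - b (z, w)} \<Longrightarrow>
         (1 - z * w)\<^sup>2 * mixed (\<lambda>p. l (a p, b p) * m (a p, b p) * (1 / (1 - a p * b p)\<^sup>2)) z w
       = (1 - a (z, w) * b (z, w))\<^sup>2 *
         mixed (\<lambda>q. l q * m q * (1 / (1 - fst q * snd q)\<^sup>2)) (a (z, w)) (b (z, w))"
  shows "dz a z w * dw a z w = 0" "dz b z w * dw b z w = 0"
    "(1 - z * w)\<^sup>2 * (dz a z w * dw b z w + dw a z w * dz b z w) = (1 - a (z, w) * b (z, w))\<^sup>2"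
proof -
  define \<alpha> \<beta> where "\<alpha> = a (z, w)" and "\<beta> = b (z, w)"
  have ne': "\<alpha> * \<beta> \<noteq> 1" using ne S(2) by (auto simp: \<alpha>_def \<beta>_def)
  let ?W = "{q. fst q * snd q \<noteq> (1 :: complex)}"
  have W: "open ?W"
    by (intro open_Collect_neq continuous_intros)
  have ha: "hol2_at (\<lambda>p. a p - \<alpha>) p" and hb: "hol2_at (\<lambda>p. b p - \<beta>) p" if "p \<in> S" for p
    using ab[OF that] by (auto intro: hol2_at_intros)
  have hf: "hol2_at (\<lambda>p. fst p - \<alpha>) p" and hs: "hol2_at (\<lambda>p. snd p - \<beta>) p" for p
    by (intro hol2_at_intros)+
  note d = partial_minus_const[OF ab(1)[OF S(2)]] partial_minus_const[OF ab(2)[OF S(2)]]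
    partial_minus_const[of fst] partial_minus_const[of snd]
  have 1: "mixed (\<lambda>p. (a p - \<alpha>) * (a p - \<alpha>) * (1 / (1 - a p * b p)\<^sup>2)) z w
      = 2 * dz a z w * dw a z w / (1 - \<alpha> * \<beta>)\<^sup>2"
    using mixed_test_function[OF S ab ha ha ne] by (simp add: d \<alpha>_def \<beta>_def)
  have 2: "mixed (\<lambda>p. (b p - \<beta>) * (b p - \<beta>) * (1 / (1 - a p * b p)\<^sup>2)) z w
      = 2 * dz b z w * dw b z w / (1 - \<alpha> * \<beta>)\<^sup>2"
    using mixed_test_function[OF S ab hb hb ne] by (simp add: d \<alpha>_def \<beta>_def)
  have 3: "mixed (\<lambda>p. (a p - \<alpha>) * (b p - \<beta>) * (1 / (1 - a p * b p)\<^sup>2)) z w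
      = (dz a z w * dw b z w + dw a z w * dz b z w) / (1 - \<alpha> * \<beta>)\<^sup>2"
    using mixed_test_function[OF S ab ha hb ne] by (simp add: d \<alpha>_def \<beta>_def)
  have 4: "mixed (\<lambda>p. (fst p - \<alpha>) * (fst p - \<alpha>) * (1 / (1 - fst p * snd p)\<^sup>2)) \<alpha> \<beta> = 0"
    by (rule trans[OF mixed_test_function[OF W]]) (use ne' in \<open>auto simp: d hf hs\<close>)
  have 5: "mixed (\<lambda>p. (snd p - \<beta>) * (snd p - \<beta>) * (1 / (1 - fst p * snd p)\<^sup>2)) \<alpha> \<beta> = 0"
    by (rule trans[OF mixed_test_function[OF W]]) (use ne' in \<open>auto simp: d hf hs\<close>)
  have 6: "mixed (\<lambda>p. (fst p - \<alpha>) * (snd p - \<beta>) * (1 / (1 - fst p * snd p)\<^sup>2)) \<alpha> \<beta>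
     = 1 / (1 - \<alpha> * \<beta>)\<^sup>2"
    by (rule trans[OF mixed_test_function[OF W]]) (use ne' in \<open>auto simp: d hf hs\<close>)
  note inv' = inv[folded \<alpha>_def \<beta>_def]
  have zw': "(1 - z * w)\<^sup>2 \<noteq> 0" "(1 - \<alpha> * \<beta>)\<^sup>2 \<noteq> 0" using zw ne' by auto
  show "dz a z w * dw a z w = 0"
    using inv'[of "\<lambda>q. fst q - \<alpha>" "\<lambda>q. fst q - \<alpha>"] zw' by (simp add: 1[simplified] 4[simplified])
  show "dz b z w * dw b z w = 0"
    using inv'[of "\<lambda>q. snd q - \<beta>" "\<lambda>q. snd q - \<beta>"] zw' by (simp add: 2[simplified] 5[simplified])
  have "(1 - z * w)\<^sup>2 * ((dz a z w * dw b z w + dw a z w * dz b z w) / (1 - \<alpha> * \<beta>)\<^sup>2)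
      = (1 - \<alpha> * \<beta>)\<^sup>2 * (1 / (1 - \<alpha> * \<beta>)\<^sup>2)"
    using inv'[of "\<lambda>q. fst q - \<alpha>" "\<lambda>q. snd q - \<beta>"] unfolding fst_conv snd_conv 3 6 by simp
  then show "(1 - z * w)\<^sup>2 * (dz a z w * dw b z w + dw a z w * dz b z w) = (1 - a (z, w) * b (z, w))\<^sup>2"
    using zw'(2) unfolding \<alpha>_def[symmetric] \<beta>_def[symmetric] by (simp add: divide_simps)
qed

section \<open>Local rigidity\<close>

text \<open>Put \<open>\<beta> = h(w\<^sub>0)\<close>, \<open>\<beta>\<^sub>1 = h'(w\<^sub>0)\<close>, \<open>\<beta>\<^sub>2 = h''(w\<^sub>0)\<close>.  Differentiating the equation in \<open>w\<close> at \<open>w\<^sub>0\<close>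
  and eliminating \<open>g'(z)\<close> with the equation itself gives a relation that is linear in \<open>g(z)\<close> with
  coefficients linear in \<open>z\<close>.  Solving it shows that \<open>g\<close> is fractional linear, with determinant
  \<open>4 \<beta>\<^sub>1\<^sup>3\<close>, which is nonzero because \<open>1 - g h\<close> has no zeros.\<close>

lemma separated_isometry_moebius:
  fixes g h :: "complex \<Rightarrow> complex"
  assumes D: "open D" "open E" "z0 \<in> D" "w0 \<in> E"
    and hol: "g holomorphic_on D" "h holomorphic_on E"
    and eq: "\<And>z w. z \<in> D \<Longrightarrow> w \<in> E \<Longrightarrow> (1 - z * w)\<^sup>2 * (deriv g z * deriv h w) = (1 - g z * h w)\<^sup>2"
    and ne: "\<And>z w. z \<in> D \<Longrightarrow> w \<in> E \<Longrightarrow> g z * h w \<noteq> 1"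
  obtains A B C E' where "A * E' - B * C \<noteq> 0"
    "\<forall>z\<in>D. g z * (C * z + E') = A * z + B"
proof -
  define \<beta> \<beta>1 \<beta>2 where "\<beta> = h w0" and "\<beta>1 = deriv h w0" and "\<beta>2 = deriv (deriv h) w0"
  have h1: "(h has_field_derivative \<beta>1) (at w0)"
    unfolding \<beta>1_def by (rule holomorphic_derivI[OF hol(2) D(2) D(4)])
  have h2: "(deriv h has_field_derivative \<beta>2) (at w0)"
    unfolding \<beta>2_def by (rule holomorphic_derivI[OF holomorphic_deriv[OF hol(2) D(2)] D(2) D(4)])
  have \<beta>1: "\<beta>1 \<noteq> 0" using eq[OF D(3,4)] ne[OF D(3,4)] by (auto simp: \<beta>1_def)
  have key: "g z * (\<beta> * (\<beta>2 * (1 - z * w0) - 2 * z * \<beta>1) - 2 * \<beta>1\<^sup>2 * (1 - z * w0))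
       = \<beta>2 * (1 - z * w0) - 2 * z * \<beta>1" if z: "z \<in> D" for z
  proof -
    define a a1 where "a = g z" and "a1 = deriv g z"
    have L: "((\<lambda>w. (1 - z * w)\<^sup>2 * (a1 * deriv h w)) has_field_derivative
         (1 - z * w0)\<^sup>2 * (a1 * \<beta>2) - 2 * (1 - z * w0) * z * (a1 * \<beta>1)) (at w0)"
      by (auto intro!: derivative_eq_intros h2  simp: \<beta>1_def algebra_simps)
    have R: "((\<lambda>w. (1 - a * h w)\<^sup>2) has_field_derivative - 2 * (1 - a * \<beta>) * a * \<beta>1) (at w0)"
      by (auto intro!: derivative_eq_intros h1  simp: \<beta>_def algebra_simps)
    have "((\<lambda>w. (1 - z * w)\<^sup>2 * (a1 * deriv h w)) has_field_derivative - 2 * (1 - a * \<beta>) * a * \<beta>1) (at w0)"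
      by (rule has_field_derivative_transform_within_open[OF R D(2) D(4)])
         (use eq[OF z] in \<open>auto simp: a_def a1_def\<close>)
    from DERIV_unique[OF L this]
    have e1: "(1 - z * w0)\<^sup>2 * (a1 * \<beta>2) - 2 * (1 - z * w0) * z * (a1 * \<beta>1) = - 2 * (1 - a * \<beta>) * a * \<beta>1" .
    have e2: "(1 - z * w0)\<^sup>2 * (a1 * \<beta>1) = (1 - a * \<beta>)\<^sup>2"
      using eq[OF z D(4)] by (simp add: a_def a1_def \<beta>_def \<beta>1_def)
    have n: "1 - a * \<beta> \<noteq> 0" using ne[OF z D(4)] by (simp add: a_def \<beta>_def)
    have "(1 - a * \<beta>)\<^sup>2 * (\<beta>2 * (1 - z * w0) - 2 * z * \<beta>1)
        = (1 - z * w0) * \<beta>1 * ((1 - z * w0)\<^sup>2 * (a1 * \<beta>2) - 2 * (1 - z * w0) * z * (a1 * \<beta>1))"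
      unfolding e2[symmetric] by (simp add: algebra_simps power2_eq_square)
    also have "\<dots> = (1 - a * \<beta>) * (- 2 * a * \<beta>1\<^sup>2 * (1 - z * w0))"
      unfolding e1 by (simp add: algebra_simps power2_eq_square)
    finally have "(1 - a * \<beta>) * ((1 - a * \<beta>) * (\<beta>2 * (1 - z * w0) - 2 * z * \<beta>1))
        = (1 - a * \<beta>) * (- 2 * a * \<beta>1\<^sup>2 * (1 - z * w0))"
      by (simp only: power2_eq_square mult.assoc)
    then have "(1 - a * \<beta>) * (\<beta>2 * (1 - z * w0) - 2 * z * \<beta>1) = - 2 * a * \<beta>1\<^sup>2 * (1 - z * w0)"
      using n by (simp only: mult_cancel_left simp_thms)
    then show ?thesis unfolding a_def[symmetric] by (simp add: algebra_simps)
  qed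
  \<comment> \<open>The coefficients of \<open>z\<close> and \<open>1\<close> on the two sides of the linear relation.\<close>
  define A where "A = - \<beta>2 * w0 - 2 * \<beta>1"
  define B where "B = \<beta>2"
  define C where "C = \<beta> * A + 2 * \<beta>1\<^sup>2 * w0"
  define E' where "E' = \<beta> * B - 2 * \<beta>1\<^sup>2"
  have "A * E' - B * C = 4 * \<beta>1 ^ 3"
    by (simp add: A_def B_def C_def E'_def algebra_simps power2_eq_square power3_eq_cube)
  then have "A * E' - B * C \<noteq> 0" using \<beta>1 by simp
  moreover have "\<forall>z\<in>D. g z * (C * z + E') = A * z + B"
    using key by (simp add: A_def B_def C_def E'_def algebra_simps)
  ultimately show ?thesis by (rule that)
qed

text \<open>Once \<open>g\<close> is known explicitly, the same elimination in the other variable determines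
  \<open>h\<close> from \<open>g\<close> and leaves no further freedom.\<close>

lemma separated_isometry:
  fixes g h :: "complex \<Rightarrow> complex"
  assumes D: "open D" "open E" "z0 \<in> D" "w0 \<in> E"
    and hol: "g holomorphic_on D" "h holomorphic_on E"
    and eq: "\<And>z w. z \<in> D \<Longrightarrow> w \<in> E \<Longrightarrow> (1 - z * w)\<^sup>2 * (deriv g z * deriv h w) = (1 - g z * h w)\<^sup>2"
    and ne: "\<And>z w. z \<in> D \<Longrightarrow> w \<in> E \<Longrightarrow> g z * h w \<noteq> 1"
  obtains A B C E' where "A * E' - B * C \<noteq> 0"
    "\<forall>z\<in>D. C * z + E' \<noteq> 0 \<and> g z = (A * z + B) / (C * z + E')"
    "\<forall>w\<in>E. A + B * w \<noteq> 0 \<and> h w = (C + E' * w) / (A + B * w)"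
proof -
  obtain A B C E' where det: "A * E' - B * C \<noteq> 0"
    and g': "\<forall>z\<in>D. g z * (C * z + E') = A * z + B"
    by (rule separated_isometry_moebius[OF D hol eq ne])
  have g: "g z * (C * z + E') = A * z + B" if "z \<in> D" for z using g' that by blast
  define \<Delta> where "\<Delta> = A * E' - B * C"
  have den: "C * z + E' \<noteq> 0" if "z \<in> D" for z
  proof
    assume 0: "C * z + E' = 0"
    with g[OF that] have 1: "A * z + B = 0" by simp
    have "A * E' - B * C = A * (C * z + E') - C * (A * z + B)" by (simp add: algebra_simps)
    with 0 1 det show False by simp
  qed
  have gq: "g z = (A * z + B) / (C * z + E')" if "z \<in> D" for z
    using g[OF that] den[OF that] by (simp add: field_simps)
  have dg: "deriv g z = \<Delta> / (C * z + E')\<^sup>2" if "z \<in> D" for z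
  proof (rule DERIV_imp_deriv)
    have "((\<lambda>z. (A * z + B) / (C * z + E')) has_field_derivative \<Delta> / (C * z + E')\<^sup>2) (at z)"
      using den[OF that]
      by (auto intro!: derivative_eq_intros simp: \<Delta>_def field_simps power2_eq_square)
    then show "(g has_field_derivative \<Delta> / (C * z + E')\<^sup>2) (at z)"
      by (rule has_field_derivative_transform_within_open[OF _ D(1) that]) (simp add: gq)
  qed
  define n where "n = C * z0 + E'"
  define m where "m = A * z0 + B"
  have n0: "n \<noteq> 0" using den[OF D(3)] by (simp add: n_def)
  have h: "h w * (A + B * w) = C + E' * w" if w: "w \<in> E" for w
  proof -
    define b b1 where "b = h w" and "b1 = deriv h w"
    have eq': "(1 - z * w)\<^sup>2 * (\<Delta> * b1) = ((C * z + E') - (A * z + B) * b)\<^sup>2" if "z \<in> D" for z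
    proof -
      let ?d = "C * z + E'" and ?n = "A * z + B"
      have d: "?d \<noteq> 0" using den[OF that] .
      have "(1 - z * w)\<^sup>2 * (\<Delta> * b1) = ?d\<^sup>2 * ((1 - z * w)\<^sup>2 * (deriv g z * deriv h w))"
        unfolding dg[OF that] b1_def using d by simp
      also have "\<dots> = (?d * (1 - ?n / ?d * b))\<^sup>2"
        unfolding eq[OF that w] gq[OF that] b_def by (simp only: power_mult_distrib)
      also have "?d * (1 - ?n / ?d * b) = ?d - ?n * b"
        using d by (simp add: right_diff_distrib)
      finally show ?thesis .
    qed
    have L: "((\<lambda>z. (1 - z * w)\<^sup>2 * (\<Delta> * b1)) has_field_derivative
         - 2 * (1 - z0 * w) * w * (\<Delta> * b1)) (at z0)"
      by (auto intro!: derivative_eq_intros  simp:  algebra_simps)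
    have R: "((\<lambda>z. ((C * z + E') - (A * z + B) * b)\<^sup>2) has_field_derivative
         2 * (n - m * b) * (C - A * b)) (at z0)"
      by (auto intro!: derivative_eq_intros  simp: n_def m_def algebra_simps)
    have "((\<lambda>z. ((C * z + E') - (A * z + B) * b)\<^sup>2) has_field_derivative
          - 2 * (1 - z0 * w) * w * (\<Delta> * b1)) (at z0)"
      by (rule has_field_derivative_transform_within_open[OF L D(1) D(3)]) (simp add: eq')
    from DERIV_unique[OF R this]
    have e1: "2 * (n - m * b) * (C - A * b) = - 2 * (1 - z0 * w) * w * (\<Delta> * b1)" .
    have e2: "(1 - z0 * w)\<^sup>2 * (\<Delta> * b1) = (n - m * b)\<^sup>2"
      using eq'[OF D(3)] by (simp add: n_def m_def)
    have nz: "n - m * b \<noteq> 0"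
      using ne[OF D(3) w] n0 unfolding gq[OF D(3)] b_def[symmetric] n_def m_def
      by (simp add: field_simps)
    have "2 * (n - m * b) * ((1 - z0 * w) * (C - A * b))
        = - 2 * w * ((1 - z0 * w)\<^sup>2 * (\<Delta> * b1))"
      using arg_cong[OF e1, of "\<lambda>x. (1 - z0 * w) * x"] by (simp add: algebra_simps power2_eq_square)
    also have "\<dots> = 2 * (n - m * b) * (- w * (n - m * b))"
      unfolding e2 by (simp add: algebra_simps power2_eq_square)
    finally have "(1 - z0 * w) * (C - A * b) = - w * (n - m * b)"
      using nz by (simp only: mult_cancel_left mult_eq_0_iff zero_neq_numeral[symmetric] simp_thms)
    then show ?thesis unfolding b_def[symmetric] n_def m_def by (simp add: algebra_simps)
  qed
  have den': "A + B * w \<noteq> 0" if "w \<in> E" for w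
  proof
    assume 0: "A + B * w = 0"
    with h[OF that] have 1: "C + E' * w = 0" by simp
    have "A * E' - B * C = E' * (A + B * w) - B * (C + E' * w)" by (simp add: algebra_simps)
    with 0 1 det show False by simp
  qed
  have hq: "h w = (C + E' * w) / (A + B * w)" if "w \<in> E" for w
    using h[OF that] den'[OF that] by (simp add: field_simps)
  show ?thesis
    by (rule that[OF det]) (simp_all add: den gq den' hq)
qed

text \<open>The zero sets of \<open>p\<close> and \<open>q\<close> are closed and complementary, hence both
  open as well.  Used along complex lines, this fixes which of two partial derivatives vanishes, and
  it asks only for continuity in one variable at a time.\<close>

lemma complementary_zero_sets:
  fixes p q :: "complex \<Rightarrow> complex"
  assumes "connected P" "continuous_on P p" "continuous_on P q"
    and alt: "\<And>x. x \<in> P \<Longrightarrow> p x = 0 \<longleftrightarrow> q x \<noteq> 0" and xy: "x \<in> P" "y \<in> P"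
  shows "p x = 0 \<longleftrightarrow> p y = 0"
proof -
  let ?Z = "{x \<in> P. p x = 0}"
  have c1: "closedin (top_of_set P) ?Z"
    by (rule continuous_closedin_preimage_constant[OF assms(2)])
  have "closedin (top_of_set P) {x \<in> P. q x = 0}"
    by (rule continuous_closedin_preimage_constant[OF assms(3)])
  moreover have "{x \<in> P. q x = 0} = P - ?Z" using alt by auto
  ultimately have "openin (top_of_set P) ?Z"
    by (auto simp: closedin_def Diff_Diff_Int Int_absorb1)
  with c1 have "?Z = {} \<or> ?Z = P" using assms(1) by (auto simp: connected_clopen)
  then show ?thesis using xy by blast
qed

lemma slices_holomorphic:
  assumes f: "\<And>x y. x \<in> P \<Longrightarrow> y \<in> Q \<Longrightarrow> hol2_at f (x, y)"
  shows "y \<in> Q \<Longrightarrow> (\<lambda>x. f (x, y)) holomorphic_on P"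
    and "x \<in> P \<Longrightarrow> (\<lambda>y. f (x, y)) holomorphic_on Q"
  unfolding holomorphic_on_def field_differentiable_def
  using hol2_at_derivative(2,3)[OF f] has_field_derivative_at_within by blast+

lemma slice_derivatives_continuous:
  assumes f: "\<And>x y. x \<in> P \<Longrightarrow> y \<in> Q \<Longrightarrow> hol2_at f (x, y)" and "open P" "open Q"
  shows "y \<in> Q \<Longrightarrow> continuous_on P (\<lambda>x. dz f x y)"
    and "x \<in> P \<Longrightarrow> continuous_on Q (\<lambda>y. dw f x y)"
proof -
  show "continuous_on P (\<lambda>x. dz f x y)" if "y \<in> Q"
    using holomorphic_on_imp_continuous_on[OF holomorphic_deriv[OF slices_holomorphic(1)[OF f that] assms(2)]]
    by (simp add: dz_def)
  show "continuous_on Q (\<lambda>y. dw f x y)" if "x \<in> P"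
    using holomorphic_on_imp_continuous_on[OF holomorphic_deriv[OF slices_holomorphic(2)[OF f that] assms(3)]]
    by (simp add: dw_def)
qed

text \<open>Here \<open>a\<close> is constant along \<open>w\<close> and \<open>b\<close> along \<open>z\<close>, so the equation separates.\<close>

lemma split_isometry_is_moebius:
  assumes P: "open P" "convex P" "z0 \<in> P" and Q: "open Q" "convex Q" "w0 \<in> Q"
    and a: "\<And>z w. z \<in> P \<Longrightarrow> w \<in> Q \<Longrightarrow> hol2_at a (z, w)"
    and b: "\<And>z w. z \<in> P \<Longrightarrow> w \<in> Q \<Longrightarrow> hol2_at b (z, w)"
    and ne: "\<And>z w. z \<in> P \<Longrightarrow> w \<in> Q \<Longrightarrow> a (z, w) * b (z, w) \<noteq> 1"
    and da: "\<And>z w. z \<in> P \<Longrightarrow> w \<in> Q \<Longrightarrow> dw a z w = 0"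
    and db: "\<And>z w. z \<in> P \<Longrightarrow> w \<in> Q \<Longrightarrow> dz b z w = 0"
    and eq: "\<And>z w. z \<in> P \<Longrightarrow> w \<in> Q \<Longrightarrow>
        (1 - z * w)\<^sup>2 * (dz a z w * dw b z w) = (1 - a (z, w) * b (z, w))\<^sup>2"
  obtains A B C D where "A * D - B * C \<noteq> 0"
    "\<forall>z\<in>P. \<forall>w\<in>Q. C * z + D \<noteq> 0 \<and> A + B * w \<noteq> 0 \<and>
        a (z, w) = (A * z + B) / (C * z + D) \<and> b (z, w) = (C + D * w) / (A + B * w)"
proof -
  have ac: "a (z, w) = a (z, w0)" if "z \<in> P" "w \<in> Q" for z w
  proof -
    have "\<exists>c. \<forall>y\<in>Q. a (z, y) = c"
    proof (rule has_field_derivative_zero_constant[OF Q(2)])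
      fix y assume "y \<in> Q"
      then show "((\<lambda>y. a (z, y)) has_field_derivative 0) (at y within Q)"
        using hol2_at_derivative(3)[OF a[OF that(1)]] da[OF that(1)] has_field_derivative_at_within
        by metis
    qed
    then show ?thesis using that Q(3) by metis
  qed
  have bc: "b (z, w) = b (z0, w)" if "z \<in> P" "w \<in> Q" for z w
  proof -
    have "\<exists>c. \<forall>x\<in>P. b (x, w) = c"
    proof (rule has_field_derivative_zero_constant[OF P(2)])
      fix x assume "x \<in> P"
      then show "((\<lambda>x. b (x, w)) has_field_derivative 0) (at x within P)"
        using hol2_at_derivative(2)[OF b] db that(2) has_field_derivative_at_within
        by metis
    qed
    then show ?thesis using that P(3) by metis
  qed
  have dac: "dz a z w = deriv (\<lambda>x. a (x, w0)) z" if "z \<in> P" "w \<in> Q" for z w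
    unfolding dz_def
    by (rule deriv_cong_ev) (use ac that P(1) eventually_nhds in blast)+
  have dbc: "dw b z w = deriv (\<lambda>y. b (z0, y)) w" if "z \<in> P" "w \<in> Q" for z w
    unfolding dw_def
    by (rule deriv_cong_ev) (use bc that Q(1) eventually_nhds in blast)+
  obtain A B C D where det: "A * D - B * C \<noteq> 0"
    and g: "\<forall>z\<in>P. C * z + D \<noteq> 0 \<and> a (z, w0) = (A * z + B) / (C * z + D)"
    and h: "\<forall>w\<in>Q. A + B * w \<noteq> 0 \<and> b (z0, w) = (C + D * w) / (A + B * w)"
  proof (rule separated_isometry[OF P(1) Q(1) P(3) Q(3)
        slices_holomorphic(1)[OF a Q(3)] slices_holomorphic(2)[OF b P(3)]])
    fix z w assume z: "z \<in> P" and w: "w \<in> Q"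
    show "(1 - z * w)\<^sup>2 * (deriv (\<lambda>x. a (x, w0)) z * deriv (\<lambda>y. b (z0, y)) w)
        = (1 - a (z, w0) * b (z0, w))\<^sup>2"
      using eq[OF z w] unfolding dac[OF z w] dbc[OF z w] ac[OF z w] bc[OF z w] .
    show "a (z, w0) * b (z0, w) \<noteq> 1"
      using ne[OF z w] unfolding ac[OF z w] bc[OF z w] .
  qed
  show ?thesis
    by (rule that[OF det]) (use g h ac bc in metis)
qed

lemma partial_swap:
  "dz (\<lambda>q. f (snd q, fst q)) w z = dw f z w" "dw (\<lambda>q. f (snd q, fst q)) w z = dz f z w"
  by (simp_all add: dz_def dw_def)

text \<open>At each point the alternative is recorded by \<open>a\<^sub>z = 0\<close>.  It is
  transported first along \<open>z\<close>, comparing \<open>a\<^sub>z\<close> with \<open>b\<^sub>z\<close>, and then along \<open>w\<close>, comparing \<open>b\<^sub>w\<close> with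
  \<open>a\<^sub>w\<close>.  The second alternative is the first one after exchanging the variables.\<close>

lemma local_isometry_is_moebius:
  assumes S: "open S" "(z0, w0) \<in> S"
    and a: "\<And>p. p \<in> S \<Longrightarrow> hol2_at a p" and b: "\<And>p. p \<in> S \<Longrightarrow> hol2_at b p"
    and ne: "\<And>p. p \<in> S \<Longrightarrow> a p * b p \<noteq> 1"
    and e1: "\<And>z w. (z, w) \<in> S \<Longrightarrow> dz a z w * dw a z w = 0"
    and e2: "\<And>z w. (z, w) \<in> S \<Longrightarrow> dz b z w * dw b z w = 0"
    and e3: "\<And>z w. (z, w) \<in> S \<Longrightarrow>
       (1 - z * w)\<^sup>2 * (dz a z w * dw b z w + dw a z w * dz b z w) = (1 - a (z, w) * b (z, w))\<^sup>2"
  obtains N A B C D where "open N" "(z0, w0) \<in> N" "N \<subseteq> S" "A * D - B * C \<noteq> 0"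
    "(\<forall>(z, w)\<in>N. C * z + D \<noteq> 0 \<and> A + B * w \<noteq> 0 \<and>
        a (z, w) = (A * z + B) / (C * z + D) \<and> b (z, w) = (C + D * w) / (A + B * w)) \<or>
     (\<forall>(z, w)\<in>N. C * w + D \<noteq> 0 \<and> A + B * z \<noteq> 0 \<and>
        a (z, w) = (A * w + B) / (C * w + D) \<and> b (z, w) = (C + D * z) / (A + B * z))"
proof -
  obtain r where r: "r > 0" and sub: "ball z0 r \<times> ball w0 r \<subseteq> S" using open_contains_polydisc S by blast
  define P Q where "P = ball z0 r" and "Q = ball w0 r"
  have P: "open P" "convex P" "connected P" "z0 \<in> P" and Q: "open Q" "convex Q" "connected Q" "w0 \<in> Q"
    using r by (auto simp: P_def Q_def)
  have PQ: "(z, w) \<in> S" if "z \<in> P" "w \<in> Q" for z w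
    using sub that by (auto simp: P_def Q_def)
  have alt: "dz a z w = 0 \<longleftrightarrow> dz b z w \<noteq> 0" "dw b z w = 0 \<longleftrightarrow> dw a z w \<noteq> 0"
    "dz a z w = 0 \<longleftrightarrow> dw b z w = 0"
    if "z \<in> P" "w \<in> Q" for z w
  proof -
    have "(1 - a (z, w) * b (z, w))\<^sup>2 \<noteq> 0" using ne[OF PQ[OF that]] by simp
    then have "dz a z w * dw b z w + dw a z w * dz b z w \<noteq> 0"
      using e3[OF PQ[OF that]] by auto
    then show "dz a z w = 0 \<longleftrightarrow> dz b z w \<noteq> 0" "dw b z w = 0 \<longleftrightarrow> dw a z w \<noteq> 0"
      "dz a z w = 0 \<longleftrightarrow> dw b z w = 0"
      using e1[OF PQ[OF that]] e2[OF PQ[OF that]] by auto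
  qed
  have aS: "hol2_at a (z, w)" and bS: "hol2_at b (z, w)" if "z \<in> P" "w \<in> Q" for z w
    using a b PQ[OF that] by auto
  have const: "dz a z w = 0 \<longleftrightarrow> dz a z0 w0 = 0" if "z \<in> P" "w \<in> Q" for z w
  proof -
    have "dz a z w = 0 \<longleftrightarrow> dz a z0 w = 0"
      by (rule complementary_zero_sets[OF P(3) slice_derivatives_continuous(1)[OF aS P(1) Q(1)]
            slice_derivatives_continuous(1)[OF bS P(1) Q(1)]])
         (use alt(1) that P(4) in auto)
    also have "\<dots> \<longleftrightarrow> dw b z0 w = 0" using alt(3) that P(4) by blast
    also have "\<dots> \<longleftrightarrow> dw b z0 w0 = 0"
      by (rule complementary_zero_sets[OF Q(3) slice_derivatives_continuous(2)[OF bS P(1) Q(1)]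
            slice_derivatives_continuous(2)[OF aS P(1) Q(1)]])
         (use alt(2) that P(4) Q(4) in auto)
    also have "\<dots> \<longleftrightarrow> dz a z0 w0 = 0" using alt(3) P(4) Q(4) by blast
    finally show ?thesis .
  qed
  have N: "open (P \<times> Q)" "(z0, w0) \<in> P \<times> Q" "P \<times> Q \<subseteq> S"
    using P Q PQ by (auto simp: open_Times)
  show ?thesis
  proof (cases "dz a z0 w0 = 0")
    case False
    then have d: "dw a z w = 0" "dz b z w = 0" if "z \<in> P" "w \<in> Q" for z w
      using const[OF that] alt[OF that] by auto
    obtain A B C D where "A * D - B * C \<noteq> 0"
      "\<forall>z\<in>P. \<forall>w\<in>Q. C * z + D \<noteq> 0 \<and> A + B * w \<noteq> 0 \<and>
        a (z, w) = (A * z + B) / (C * z + D) \<and> b (z, w) = (C + D * w) / (A + B * w)"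
    proof (rule split_isometry_is_moebius[OF P(1,2,4) Q(1,2,4) aS bS])
      fix z w assume zw: "z \<in> P" "w \<in> Q"
      show "(1 - z * w)\<^sup>2 * (dz a z w * dw b z w) = (1 - a (z, w) * b (z, w))\<^sup>2"
        using e3[OF PQ[OF zw]] d[OF zw] by simp
    qed (use ne PQ d in auto)
    with that[OF N] show ?thesis by blast
  next
    case True
    then have d: "dz a z w = 0" "dw b z w = 0" if "z \<in> P" "w \<in> Q" for z w
      using const[OF that] alt[OF that] by auto
    let ?a = "\<lambda>q. a (snd q, fst q)" and ?b = "\<lambda>q. b (snd q, fst q)"
    obtain A B C D where "A * D - B * C \<noteq> 0"
      "\<forall>w\<in>Q. \<forall>z\<in>P. C * w + D \<noteq> 0 \<and> A + B * z \<noteq> 0 \<and>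
        ?a (w, z) = (A * w + B) / (C * w + D) \<and> ?b (w, z) = (C + D * z) / (A + B * z)"
    proof (rule split_isometry_is_moebius[OF Q(1,2,4) P(1,2,4)])
      fix w z assume zw: "w \<in> Q" "z \<in> P"
      show "hol2_at ?a (w, z)" "hol2_at ?b (w, z)"
        using hol2_at_swap aS bS zw by blast+
      show "dw ?a w z = 0" "dz ?b w z = 0" unfolding partial_swap using d zw by auto
      show "?a (w, z) * ?b (w, z) \<noteq> 1" using ne PQ zw by auto
      show "(1 - w * z)\<^sup>2 * (dz ?a w z * dw ?b w z) = (1 - ?a (w, z) * ?b (w, z))\<^sup>2"
        unfolding partial_swap using e3[OF PQ[OF zw(2,1)]] d[OF zw(2,1)] by (simp add: mult.commute)
    qed auto
    then have "\<forall>(z, w)\<in>P \<times> Q. C * w + D \<noteq> 0 \<and> A + B * z \<noteq> 0 \<and>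
        a (z, w) = (A * w + B) / (C * w + D) \<and> b (z, w) = (C + D * z) / (A + B * z)" by auto
    with that[OF N \<open>A * D - B * C \<noteq> 0\<close>] show ?thesis by blast
  qed
qed

section \<open>The two charts\<close>

definition emb :: "complex \<times> complex \<Rightarrow> sphere \<times> sphere" where
  "emb q = (Some (fst q), Some (snd q))"

text \<open>The transition between the two charts.\<close>

definition recip_swap :: "sphere \<times> sphere \<Rightarrow> sphere \<times> sphere" where
  "recip_swap p = (sphere_inverse (snd p), sphere_inverse (fst p))"

text \<open>The common image of both charts.\<close>

definition coord_domain :: "(complex \<times> complex) set" where
  "coord_domain = {q. fst q * snd q \<noteq> 1}"

text \<open>Chart \<open>c\<close> is the first chart after \<open>chart_flip c\<close>; see \<open>chart_map_eq\<close> and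
  \<open>chart_inv_eq\<close>.\<close>

definition chart_flip :: "chart \<Rightarrow> sphere \<times> sphere \<Rightarrow> sphere \<times> sphere" where
  "chart_flip c = (case c of Plus \<Rightarrow> id | Minus \<Rightarrow> recip_swap)"

lemma sphere_inverse_sphere_inverse [simp]: "sphere_inverse (sphere_inverse x) = x"
  by (cases x) auto

lemma sphere_inverse_eq_iff [simp]: "sphere_inverse x = sphere_inverse y \<longleftrightarrow> x = y"
  by (metis sphere_inverse_sphere_inverse)

lemma sphere_mult_eq_1_iff: "sphere_mult x y = Some 1 \<longleftrightarrow> x = sphere_inverse y"
  by (cases x; cases y) (auto simp: field_simps)

lemma Omega_iff: "p \<in> Omega \<longleftrightarrow> fst p \<noteq> sphere_inverse (snd p)"
  by (cases p) (auto simp: Omega_def sphere_mult_eq_1_iff)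

lemma recip_swap_recip_swap [simp]: "recip_swap (recip_swap p) = p"
  by (simp add: recip_swap_def)

lemma chart_flip_chart_flip [simp]: "chart_flip c (chart_flip c p) = p"
  by (cases c) (auto simp: chart_flip_def)

lemma chart_flip_in_Omega_iff [simp]: "chart_flip c p \<in> Omega \<longleftrightarrow> p \<in> Omega"
  by (cases c) (auto simp: chart_flip_def Omega_iff recip_swap_def)

lemma open_coord_domain: "open coord_domain"
  unfolding coord_domain_def by (intro open_Collect_neq continuous_intros)

lemma emb_in_Omega_iff [simp]: "emb q \<in> Omega \<longleftrightarrow> q \<in> coord_domain"
  by (auto simp: Omega_iff emb_def coord_domain_def divide_simps)

lemma emb_eq_iff [simp]: "emb p = emb q \<longleftrightarrow> p = q"
  by (auto simp: emb_def prod_eq_iff)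

lemma chart_domain_Plus: "chart_domain Plus = emb ` coord_domain"
proof (intro set_eqI iffI)
  fix p assume "p \<in> chart_domain Plus"
  then obtain z w where p: "p = emb (z, w)" and "p \<in> Omega"
    by (cases p) (auto simp: emb_def)
  then show "p \<in> emb ` coord_domain" by auto
qed (auto simp: emb_def Omega_iff coord_domain_def divide_simps split: if_splits)

lemma chart_map_eq: "chart_map c p = chart_map Plus (chart_flip c p)"
  by (cases p; cases c) (auto simp: chart_flip_def recip_swap_def)

lemma chart_map_Plus_emb [simp]: "chart_map Plus (emb q) = q"
  by (simp add: emb_def)

lemma chart_domain_iff: "p \<in> chart_domain c \<longleftrightarrow> (\<exists>q\<in>coord_domain. p = chart_flip c (emb q))"
proof -
  have "p \<in> chart_domain c \<longleftrightarrow> chart_flip c p \<in> chart_domain Plus"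
  proof (cases c)
    case Minus
    obtain u v where "p = (u, v)" by (cases p)
    then show ?thesis using Minus chart_flip_in_Omega_iff[of Minus p]
      by (cases u; cases v) (auto simp: chart_flip_def recip_swap_def)
  qed (simp add: chart_flip_def)
  also have "\<dots> \<longleftrightarrow> (\<exists>q\<in>coord_domain. p = chart_flip c (emb q))"
    unfolding chart_domain_Plus by (auto simp: image_iff) (metis chart_flip_chart_flip)
  finally show ?thesis .
qed

lemma chart_inv_eq:
  assumes "q \<in> coord_domain"
  shows "chart_inv c q = chart_flip c (emb q)"
  unfolding chart_inv_def
proof (rule inv_into_f_eq)
  show "inj_on (chart_map c) (chart_domain c)"
    by (rule inj_on_inverseI[where g = "\<lambda>q. chart_flip c (emb q)"])
       (auto simp: chart_domain_iff chart_map_eq[of c] simp del: chart_map.simps)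
qed (use assms in \<open>auto simp: chart_domain_iff chart_map_eq[of c]\<close>)

lemma chart_inv_in [simp]:
  assumes "q \<in> coord_domain"
  shows "chart_inv c q \<in> chart_domain c" "chart_inv c q \<in> Omega" "chart_map c (chart_inv c q) = q"
  using assms by (auto simp: chart_inv_eq chart_domain_iff chart_map_eq[of c])

lemma chart_map_in:
  assumes "p \<in> chart_domain c"
  shows "chart_map c p \<in> coord_domain" "chart_inv c (chart_map c p) = p"
  using assms by (auto simp: chart_inv_eq chart_domain_iff chart_map_eq[of c])

lemma chart_cover:
  assumes "p \<in> Omega"
  obtains c q where "q \<in> coord_domain" "p = chart_inv c q"
proof -
  have "p \<in> chart_domain Plus \<or> p \<in> chart_domain Minus"
    using assms by (cases "fst p"; cases "snd p"; cases p) (auto simp: Omega_iff)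
  then show ?thesis using that chart_map_in by metis
qed

declare chart_domain.simps [simp del] chart_map.simps [simp del]

lemma chart_image: "chart_map c ` (V \<inter> chart_domain c) = {q \<in> coord_domain. chart_inv c q \<in> V}"
proof (intro set_eqI iffI)
  fix q assume "q \<in> chart_map c ` (V \<inter> chart_domain c)"
  then obtain p where "p \<in> V" "p \<in> chart_domain c" "q = chart_map c p" by blast
  then show "q \<in> {q \<in> coord_domain. chart_inv c q \<in> V}" using chart_map_in by simp
next
  fix q assume q: "q \<in> {q \<in> coord_domain. chart_inv c q \<in> V}"
  then have "q = chart_map c (chart_inv c q)" "chart_inv c q \<in> V \<inter> chart_domain c" by auto
  then show "q \<in> chart_map c ` (V \<inter> chart_domain c)" by (rule image_eqI)
qed

section \<open>Topology of the charts\<close>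

text \<open>In terms of norms, continuity of inversion at zero and infinity becomes an estimate.\<close>

lemma openin_sphere_iff:
  "openin sphere_topology V \<longleftrightarrow>
     open {z. Some z \<in> V} \<and> (infty \<in> V \<longrightarrow> (\<exists>R>0. \<forall>z. norm z > R \<longrightarrow> Some z \<in> V))"
proof
  assume "openin sphere_topology V"
  then consider U where "open U" "V = Some ` U"
    | K where "compact K" "V = insert None (Some ` (- K))"
    by (auto simp: openin_Alexandroff_compactification Compl_eq_Diff_UNIV)
  then show "open {z. Some z \<in> V} \<and> (infty \<in> V \<longrightarrow> (\<exists>R>0. \<forall>z. norm z > R \<longrightarrow> Some z \<in> V))"
  proof cases
    case 1
    then have "{z. Some z \<in> V} = U" by auto
    with 1 show ?thesis by auto
  next
    case 2
    then have "{z. Some z \<in> V} = - K" by auto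
    moreover obtain R where "R > 0" "\<forall>z\<in>K. norm z \<le> R"
      using 2(1) compact_imp_bounded bounded_pos by blast
    moreover from this have "\<forall>z. norm z > R \<longrightarrow> Some z \<in> V" using 2(2) by (auto simp: not_le[symmetric])
    ultimately show ?thesis using 2 by (auto intro!: exI[of _ R] open_Compl compact_imp_closed)
  qed
next
  assume *: "open {z. Some z \<in> V} \<and> (infty \<in> V \<longrightarrow> (\<exists>R>0. \<forall>z. norm z > R \<longrightarrow> Some z \<in> V))"
  show "openin sphere_topology V"
  proof (cases "infty \<in> V")
    case False
    have "x \<in> V \<longleftrightarrow> x \<in> Some ` {z. Some z \<in> V}" for x using False by (cases x) auto
    then have "V = Some ` {z. Some z \<in> V}" by blast
    moreover have "openin sphere_topology (Some ` {z. Some z \<in> V})" using * by simp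
    ultimately show ?thesis by simp
  next
    case True
    let ?K = "{z. Some z \<notin> V}"
    obtain R where "\<forall>z. norm z > R \<longrightarrow> Some z \<in> V" using * True by auto
    then have "bounded ?K" by (auto simp: bounded_iff intro!: exI[of _ R]) (meson leI)
    moreover have "closed ?K" using * by (simp add: closed_def Compl_eq)
    ultimately have K: "compact ?K" by (simp add: compact_eq_bounded_closed)
    have "x \<in> V \<longleftrightarrow> x \<in> insert None (Some ` (UNIV - ?K))" for x using True by (cases x) auto
    then have V: "V = insert None (Some ` (UNIV - ?K))" by blast
    have "compactin euclidean ?K \<and> closedin euclidean ?K"
      using K compact_imp_closed by simp
    then show ?thesis
      unfolding openin_Alexandroff_compactification topspace_euclidean using V by blast
  qed
qed

lemma continuous_map_sphere_inverse: "continuous_map sphere_topology sphere_topology sphere_inverse"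
proof -
  have "openin sphere_topology {x. sphere_inverse x \<in> V}" if V: "openin sphere_topology V" for V
    unfolding openin_sphere_iff
  proof (intro conjI impI)
    have o: "open {z. Some z \<in> V}" using V openin_sphere_iff by blast
    have "open (- {0 :: complex} \<inter> (\<lambda>z. 1 / z) -` {z. Some z \<in> V})"
      by (rule continuous_open_preimage) (auto intro!: continuous_intros o)
    then have o1: "open {z. z \<noteq> 0 \<and> Some (1 / z) \<in> V}"
      by (rule back_subst[of "open"]) auto
    show "open {z. Some z \<in> {x. sphere_inverse x \<in> V}}"
    proof (cases "infty \<in> V")
      case True
      then obtain R where R: "R > 0" "\<And>z. norm z > R \<Longrightarrow> Some z \<in> V"
        using V openin_sphere_iff by blast
      have "Some (1 / z) \<in> V" if "z \<noteq> 0" "norm z < 1 / R" for z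
        by (rule R(2)) (use that R(1) in \<open>auto simp: norm_divide field_simps\<close>)
      then have "{z. Some z \<in> {x. sphere_inverse x \<in> V}} = {z. z \<noteq> 0 \<and> Some (1 / z) \<in> V} \<union> ball 0 (1 / R)"
        using True R(1) by auto
      then show ?thesis using o1 by auto
    next
      case False
      then have "{z. Some z \<in> {x. sphere_inverse x \<in> V}} = {z. z \<noteq> 0 \<and> Some (1 / z) \<in> V}"
        by auto
      then show ?thesis using o1 by auto
    qed
    assume "infty \<in> {x. sphere_inverse x \<in> V}"
    then have "0 \<in> {z. Some z \<in> V}" by simp
    then obtain e where e: "e > 0" "ball 0 e \<subseteq> {z. Some z \<in> V}" using o openE by blast
    have "sphere_inverse (Some z) \<in> V" if "norm z > 1 / e" for z
    proof -
      have "z \<noteq> 0" using that e(1) by auto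
      moreover have "1 / z \<in> ball 0 e"
        using that e(1) \<open>z \<noteq> 0\<close> by (simp add: norm_divide field_simps)
      ultimately show ?thesis using e(2) by auto
    qed
    then show "\<exists>R>0. \<forall>z. R < norm z \<longrightarrow> Some z \<in> {x. sphere_inverse x \<in> V}"
      using e(1) by (intro exI[of _ "1 / e"]) auto
  qed
  moreover have "topspace sphere_topology = UNIV"
    by (auto simp: image_iff)
  ultimately show ?thesis by (auto simp: continuous_map_def)
qed

lemma topspace_sphere2: "topspace sphere2_topology = UNIV"
  by (auto simp: image_iff)

lemma topspace_Omega [simp]: "topspace Omega_topology = Omega"
  unfolding Omega_topology_def by (simp add: topspace_sphere2 del: topspace_prod_topology)

lemma continuous_map_chart_flip: "continuous_map sphere2_topology sphere2_topology (chart_flip c)"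
proof (cases c)
  case Minus
  have "continuous_map sphere2_topology sphere2_topology
     (\<lambda>p. ((sphere_inverse \<circ> snd) p, (sphere_inverse \<circ> fst) p))"
    by (intro continuous_map_pairedI continuous_map_compose[OF _ continuous_map_sphere_inverse]
          continuous_map_fst continuous_map_snd)
  then show ?thesis using Minus by (simp add: chart_flip_def recip_swap_def[abs_def])
qed (simp add: chart_flip_def)

lemma continuous_map_emb: "continuous_map euclidean sphere2_topology emb"
proof -
  have "continuous_map (prod_topology euclidean euclidean) sphere2_topology
     (\<lambda>q. ((Some \<circ> fst) q, (Some \<circ> snd) q))"
    by (intro continuous_map_pairedI continuous_map_compose[OF _ continuous_map_Some]
          continuous_map_fst continuous_map_snd)
  then show ?thesis by (simp add: emb_def[abs_def])
qed

lemma openin_emb_image: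
  assumes "open N" shows "openin sphere2_topology (emb ` N)"
proof (subst openin_subopen, intro ballI)
  fix p assume "p \<in> emb ` N"
  then obtain z w where p: "p = emb (z, w)" and "(z, w) \<in> N" by auto
  then obtain A B where AB: "open A" "open B" "(z, w) \<in> A \<times> B" "A \<times> B \<subseteq> N"
    using open_prod_elim[OF assms] by metis
  have "openin sphere2_topology (Some ` A \<times> Some ` B)"
    using AB by (simp add: openin_prod_Times_iff)
  moreover have "Some ` A \<times> Some ` B \<subseteq> emb ` N"
  proof
    fix x assume "x \<in> Some ` A \<times> Some ` B"
    then obtain u v where "x = emb (u, v)" "u \<in> A" "v \<in> B" by (auto simp: emb_def)
    then show "x \<in> emb ` N" using AB(4) by auto
  qed
  moreover have "emb (z, w) \<in> Some ` A \<times> Some ` B" using AB(3) by (auto simp: emb_def)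
  ultimately show "\<exists>T. openin sphere2_topology T \<and> p \<in> T \<and> T \<subseteq> emb ` N"
    unfolding p by (intro exI[of _ "Some ` A \<times> Some ` B"] conjI)
qed

lemma open_chart_preimage:
  assumes "openin Omega_topology V"
  shows "open {q \<in> coord_domain. chart_inv c q \<in> V}"
proof -
  obtain V' where V': "openin sphere2_topology V'" "V = V' \<inter> Omega"
    using assms by (auto simp: Omega_topology_def openin_subtopology)
  have "open {q. (chart_flip c \<circ> emb) q \<in> V'}"
    using openin_continuous_map_preimage[OF
        continuous_map_compose[OF continuous_map_emb continuous_map_chart_flip] V'(1)] by simp
  then have "open (coord_domain \<inter> {q. (chart_flip c \<circ> emb) q \<in> V'})"
    using open_coord_domain by blast
  then show ?thesis
    by (rule back_subst[of "open"]) (auto simp: chart_inv_eq V'(2))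
qed

lemma openin_chart_inv_image:
  assumes "open N" "N \<subseteq> coord_domain"
  shows "openin Omega_topology (chart_inv c ` N)"
proof -
  have "openin sphere2_topology {p. chart_flip c p \<in> emb ` N}"
    using openin_continuous_map_preimage[OF continuous_map_chart_flip[of c] openin_emb_image[OF assms(1)]]
    by (simp add: topspace_sphere2 del: topspace_prod_topology)
  moreover have "{p. chart_flip c p \<in> emb ` N} = chart_inv c ` N"
  proof (intro set_eqI iffI)
    fix p assume "p \<in> {p. chart_flip c p \<in> emb ` N}"
    then obtain q where "q \<in> N" "chart_flip c p = emb q" by auto
    then have "p = chart_flip c (emb q)" by (metis chart_flip_chart_flip)
    then show "p \<in> chart_inv c ` N" using \<open>q \<in> N\<close> assms(2) chart_inv_eq by (metis image_eqI subsetD)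
  qed (use assms(2) in \<open>auto simp: chart_inv_eq subset_iff\<close>)
  moreover have "chart_inv c ` N \<subseteq> Omega" using assms(2) by auto
  ultimately show ?thesis
    unfolding Omega_topology_def openin_subtopology by (intro exI[of _ "chart_inv c ` N"]) auto
qed

lemma openin_chart_domain: "openin Omega_topology (chart_domain c)"
proof -
  have "chart_domain c = chart_inv c ` coord_domain"
    by (auto simp: chart_domain_iff chart_inv_eq)
  then show ?thesis using openin_chart_inv_image[OF open_coord_domain] by simp
qed

section \<open>The Laplacian in coordinates\<close>

lemma holomorphic_functions_Omega_iff:
  "F \<in> holomorphic_functions Omega \<longleftrightarrow> (\<forall>c. \<forall>q\<in>coord_domain. hol2_at (F \<circ> chart_inv c) q)"
proof -
  have "{q \<in> coord_domain. chart_inv c q \<in> Omega} = coord_domain" for c by (auto simp del: split_paired_All)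
  then show ?thesis
    by (simp add: holomorphic_functions_def holomorphic2_on_iff chart_image)
qed

lemma chart_laplacian_chart_inv:
  assumes "(z, w) \<in> coord_domain"
  shows "chart_laplacian c F (chart_inv c (z, w)) = 4 * ((1 - z * w)\<^sup>2 * mixed (F \<circ> chart_inv c) z w)"
  using assms by (simp add: chart_laplacian_def mixed_def)

text \<open>By definition the Laplacian is computed in the first chart on the overlap.  The transition map is the
  exchange of variables followed by \<open>(z, w) \<mapsto> (1/z, 1/w)\<close>, which is the case \<open>A = D = 0\<close>,
  \<open>B = C = 1\<close> of \<open>mixed_moebius\<close>.\<close>

lemma laplacian_chart_inv:
  assumes N: "open N" "(z, w) \<in> N" "N \<subseteq> coord_domain"
    and f: "\<And>q. q \<in> N \<Longrightarrow> hol2_at (F \<circ> chart_inv c) q"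
  shows "laplacian F (chart_inv c (z, w)) = 4 * ((1 - z * w)\<^sup>2 * mixed (F \<circ> chart_inv c) z w)"
proof (cases "chart_inv c (z, w) \<in> chart_domain Plus \<and> c = Minus")
  case False
  have zw: "(z, w) \<in> coord_domain" using N by blast
  have "laplacian F (chart_inv c (z, w)) = chart_laplacian c F (chart_inv c (z, w))"
    using False chart_inv_in(1)[OF zw, of c] by (cases c) (auto simp: laplacian_def)
  then show ?thesis using chart_laplacian_chart_inv[OF zw] by simp
next
  case True
  then have c: "c = Minus" by simp
  have zw: "(z, w) \<in> coord_domain" using N by blast
  then have ne: "z \<noteq> 0" "w \<noteq> 0" "z * w \<noteq> 1"
    using True by (auto simp: chart_domain.simps chart_inv_eq chart_flip_def recip_swap_def emb_def coord_domain_def)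
  have eq: "chart_inv Plus (x, y) = chart_inv Minus (1 / y, 1 / x)"
    if "x \<noteq> 0" "y \<noteq> 0" "x * y \<noteq> 1" for x y
    using that by (simp add: chart_inv_eq coord_domain_def chart_flip_def recip_swap_def emb_def field_simps)
  let ?f = "F \<circ> chart_inv Minus"
  let ?fs = "\<lambda>q. ?f (snd q, fst q)"
  define N' where "N' = (\<lambda>q. (snd q, fst q)) -` N"
  have N': "open N'" "(w, z) \<in> N'"
    using open_swap[OF N(1)] N(2) by (auto simp: N'_def)
  have fN: "hol2_at ?f q" if "q \<in> N" for q using f that c by simp
  have fs: "hol2_at ?fs q" if "q \<in> N'" for q
    using hol2_at_swap[of ?f "snd q" "fst q"] fN that by (simp add: N'_def)
  have wz: "(1 / w, 1 / z) \<in> coord_domain" using ne by (auto simp: coord_domain_def mult.commute)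
  have "laplacian F (chart_inv c (z, w)) = chart_laplacian Plus F (chart_inv Plus (1 / w, 1 / z))"
    using True eq[of "1 / w" "1 / z"] ne by (auto simp: laplacian_def mult.commute)
  also have "\<dots> = 4 * ((1 - 1 / w * (1 / z))\<^sup>2 * mixed (F \<circ> chart_inv Plus) (1 / w) (1 / z))"
    by (rule chart_laplacian_chart_inv[OF wz])
  also have "mixed (F \<circ> chart_inv Plus) (1 / w) (1 / z)
      = mixed (\<lambda>q. ?fs ((0 * fst q + 1) / (1 * fst q + 0), (1 + 0 * snd q) / (0 + 1 * snd q))) (1 / w) (1 / z)"
  proof (rule mixed_cong)
    show "open (coord_domain \<inter> ((- {0}) \<times> (- {0})))"
      by (intro open_Int open_coord_domain open_Times) auto
    fix q assume "q \<in> coord_domain \<inter> ((- {0}) \<times> (- {0}))"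
    then have "chart_inv Plus (fst q, snd q) = chart_inv Minus (1 / snd q, 1 / fst q)"
      by (intro eq) (auto simp: coord_domain_def)
    then show "(F \<circ> chart_inv Plus) q
        = ?fs ((0 * fst q + 1) / (1 * fst q + 0), (1 + 0 * snd q) / (0 + 1 * snd q))" by simp
  qed (use wz ne in auto)
  also have "(1 - 1 / w * (1 / z))\<^sup>2 * \<dots> = (1 - w * z)\<^sup>2 * mixed ?fs w z"
    using mixed_moebius[OF N'(1) _ fs, of 0 "1 / w" 1 1 0 "1 / z"] N'(2) ne by simp
  also have "mixed ?fs w z = mixed ?f z w"
    by (rule mixed_swap[OF N(1,2) fN])
  finally show ?thesis using c by (simp add: mult.commute)
qed

section \<open>The group of double Moebius maps\<close>

text \<open>On the complexified sphere \<open>\<Omega>\<close> this extends the action of \<open>\<psi>\<close> to both factors: \<open>\<Omega>\<close> is the set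
  \<open>z \<noteq> 1/w\<close>, and \<open>\<psi>\<close> acts on \<open>z\<close> and on \<open>1/w\<close> simultaneously.\<close>

definition double_map :: "(sphere \<Rightarrow> sphere) \<Rightarrow> sphere \<times> sphere \<Rightarrow> sphere \<times> sphere" where
  "double_map \<psi> p = (\<psi> (fst p), sphere_inverse (\<psi> (sphere_inverse (snd p))))"

text \<open>The elements of the group as total functions, so that composition
  and equality need no restriction to \<open>\<Omega>\<close>.\<close>

definition isometries :: "(sphere \<times> sphere \<Rightarrow> sphere \<times> sphere) set" where
  "isometries = double_map ` Aut_sphere \<union> (\<lambda>\<psi>. double_map \<psi> \<circ> prod.swap) ` Aut_sphere"

lemma isometries_cases:
  assumes "S \<in> isometries"
  obtains A B C D where "A * D - B * C \<noteq> 0" "S = double_map (sphere_moebius A B C D)"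
  | A B C D where "A * D - B * C \<noteq> 0" "S = double_map (sphere_moebius A B C D) \<circ> prod.swap"
  using assms unfolding isometries_def Aut_sphere_def by blast

lemma sphere_moebius_in_Aut: "A * D - B * C \<noteq> 0 \<Longrightarrow> sphere_moebius A B C D \<in> Aut_sphere"
  unfolding Aut_sphere_def by blast

lemma sphere_moebius_inverse_right:
  "sphere_moebius A B C D \<circ> sphere_inverse = sphere_moebius B A D C"
proof
  fix x show "(sphere_moebius A B C D \<circ> sphere_inverse) x = sphere_moebius B A D C x"
  proof (cases x)
    case (Some z)
    show ?thesis
    proof (cases "z = 0")
      case False
      then have "A * (1 / z) + B = (B * z + A) / z" "C * (1 / z) + D = (D * z + C) / z"
        by (simp_all add: field_simps)
      then show ?thesis using Some False by (simp add: moebius_def)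
    qed (use Some in \<open>simp add: moebius_def\<close>)
  qed (simp add: moebius_def)
qed

lemma sphere_moebius_inverse_left:
  assumes "A * D - B * C \<noteq> 0"
  shows "sphere_inverse \<circ> sphere_moebius A B C D = sphere_moebius C D A B"
proof
  fix x show "(sphere_inverse \<circ> sphere_moebius A B C D) x = sphere_moebius C D A B x"
  proof (cases x)
    case None
    then show ?thesis using assms by auto
  next
    case (Some z)
    have "\<not> (C * z + D = 0 \<and> A * z + B = 0)"
    proof
      assume "C * z + D = 0 \<and> A * z + B = 0"
      moreover have "A * D - B * C = A * (C * z + D) - C * (A * z + B)" by (simp add: algebra_simps)
      ultimately show False using assms by simp
    qed
    then show ?thesis using Some by (auto simp: moebius_def)
  qed
qed

lemma Aut_sphere_inverse_comp:
  assumes "\<psi> \<in> Aut_sphere"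
  shows "\<psi> \<circ> sphere_inverse \<in> Aut_sphere" "sphere_inverse \<circ> \<psi> \<in> Aut_sphere"
proof -
  obtain A B C D where \<psi>: "\<psi> = sphere_moebius A B C D" and det: "A * D - B * C \<noteq> 0"
    using assms by (auto simp: Aut_sphere_def)
  have "B * C - A * D \<noteq> 0" "C * B - D * A \<noteq> 0" using det by (auto simp: mult.commute)
  then show "\<psi> \<circ> sphere_inverse \<in> Aut_sphere" "sphere_inverse \<circ> \<psi> \<in> Aut_sphere"
    unfolding \<psi> sphere_moebius_inverse_right sphere_moebius_inverse_left[OF det]
    by (auto intro: sphere_moebius_in_Aut)
qed

lemma sphere_moebius_cancel:
  assumes det: "A * D - B * C \<noteq> 0"
  shows "sphere_moebius D (- B) (- C) A (sphere_moebius A B C D x) = x"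
proof (cases x)
  case None
  then show ?thesis using det by (auto simp: moebius_def field_simps)
next
  case (Some z)
  show ?thesis
  proof (cases "C * z + D = 0")
    case True
    have "C \<noteq> 0" using True det by auto
    moreover have "z * C = - D" using True by (simp add: eq_neg_iff_add_eq_0 mult.commute)
    ultimately show ?thesis using True Some by (simp add: field_simps)
  next
    case False
    have d: "- C * ((A * z + B) / (C * z + D)) + A = (A * D - B * C) / (C * z + D)"
      using False by (simp add: field_simps)
    have n: "D * ((A * z + B) / (C * z + D)) + - B = (A * D - B * C) * z / (C * z + D)"
      using False by (simp add: field_simps)
    show ?thesis
      using Some False det d n by (simp add: moebius_def)
  qed
qed

lemma Aut_sphere_inverse:
  assumes "\<psi> \<in> Aut_sphere"
  obtains \<phi> where "\<phi> \<in> Aut_sphere" "\<forall>x. \<phi> (\<psi> x) = x" "\<forall>x. \<psi> (\<phi> x) = x"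
proof -
  obtain A B C D where \<psi>: "\<psi> = sphere_moebius A B C D" and det: "A * D - B * C \<noteq> 0"
    using assms by (auto simp: Aut_sphere_def)
  have det': "D * A - - B * - C \<noteq> 0" using det by (simp add: mult.commute)
  show ?thesis
    by (rule that[of "sphere_moebius D (- B) (- C) A"])
       (use sphere_moebius_cancel[OF det] sphere_moebius_cancel[OF det'] sphere_moebius_in_Aut[OF det']
         in \<open>simp_all add: \<psi>\<close>)
qed

text \<open>The involution \<open>recip_swap\<close> commutes with every element, and composing it with a double map
  of \<open>\<psi>\<close> gives the swapped double map of \<open>\<psi> \<circ> (1/z)\<close>, and conversely.\<close>

lemma isometries_chart_flip:
  assumes "S \<in> isometries"
  shows "chart_flip d \<circ> S \<circ> chart_flip c \<in> isometries"
proof -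
  have left: "recip_swap \<circ> S \<in> isometries" if S: "S \<in> isometries" for S
  proof -
    from S consider \<psi> where "\<psi> \<in> Aut_sphere" "S = double_map \<psi>"
      | \<psi> where "\<psi> \<in> Aut_sphere" "S = double_map \<psi> \<circ> prod.swap"
      by (auto simp: isometries_def)
    then show ?thesis
    proof cases
      case 1
      then have "recip_swap \<circ> S = double_map (\<psi> \<circ> sphere_inverse) \<circ> prod.swap"
        by (auto simp: recip_swap_def double_map_def)
      then show ?thesis using Aut_sphere_inverse_comp(1)[OF 1(1)] by (auto simp: isometries_def)
    next
      case 2
      then have "recip_swap \<circ> S = double_map (\<psi> \<circ> sphere_inverse)"
        by (auto simp: recip_swap_def double_map_def fun_eq_iff)
      then show ?thesis using Aut_sphere_inverse_comp(1)[OF 2(1)] by (auto simp: isometries_def)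
    qed
  qed
  have "S \<circ> recip_swap = recip_swap \<circ> S"
    using assms by (auto simp: isometries_def recip_swap_def double_map_def fun_eq_iff)
  then have right: "S \<circ> recip_swap \<in> isometries" using left[OF assms] by simp
  show ?thesis
    using assms left right left[OF right]
    by (cases c; cases d) (simp_all add: chart_flip_def comp_assoc)
qed

lemma isometries_Omega_iff:
  assumes "S \<in> isometries"
  shows "S p \<in> Omega \<longleftrightarrow> p \<in> Omega"
proof -
  have inj: "\<psi> x = \<psi> y \<longleftrightarrow> x = y" if "\<psi> \<in> Aut_sphere" for \<psi> x y
    by (rule Aut_sphere_inverse[OF that]) metis
  have *: "double_map \<psi> p \<in> Omega \<longleftrightarrow> p \<in> Omega" if "\<psi> \<in> Aut_sphere" for \<psi> p
    using inj[OF that] by (simp add: Omega_iff double_map_def)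
  have sw: "prod.swap p \<in> Omega \<longleftrightarrow> p \<in> Omega"
    by (cases p) (auto simp: Omega_iff)
  from assms consider \<psi> where "\<psi> \<in> Aut_sphere" "S = double_map \<psi>"
      | \<psi> where "\<psi> \<in> Aut_sphere" "S = double_map \<psi> \<circ> prod.swap"
      by (auto simp: isometries_def)
  then show ?thesis by cases (simp_all only: * sw comp_apply)
qed

lemma isometries_inverse:
  assumes "S \<in> isometries"
  obtains S' where "S' \<in> isometries" "\<forall>p. S' (S p) = p" "\<forall>p. S (S' p) = p"
proof -
  from assms consider \<psi> where "\<psi> \<in> Aut_sphere" "S = double_map \<psi>"
      | \<psi> where "\<psi> \<in> Aut_sphere" "S = double_map \<psi> \<circ> prod.swap"
      by (auto simp: isometries_def)
  then show ?thesis
  proof cases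
    case 1
    obtain \<phi> where \<phi>: "\<phi> \<in> Aut_sphere" "\<forall>x. \<phi> (\<psi> x) = x" "\<forall>x. \<psi> (\<phi> x) = x"
      by (rule Aut_sphere_inverse[OF 1(1)])
    show ?thesis
      by (rule that[of "double_map \<phi>"]) (use \<phi> 1 in \<open>auto simp: isometries_def double_map_def\<close>)
  next
    case 2
    obtain \<phi> where \<phi>: "\<phi> \<in> Aut_sphere" "\<forall>x. \<phi> (\<psi> x) = x" "\<forall>x. \<psi> (\<phi> x) = x"
      by (rule Aut_sphere_inverse[OF 2(1)])
    have "sphere_inverse \<circ> (\<phi> \<circ> sphere_inverse) \<in> Aut_sphere"
      using \<phi>(1) Aut_sphere_inverse_comp by blast
    then show ?thesis
      by (intro that[of "double_map (sphere_inverse \<circ> (\<phi> \<circ> sphere_inverse)) \<circ> prod.swap"])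
         (use \<phi> 2 in \<open>auto simp: isometries_def double_map_def\<close>)
  qed
qed

text \<open>The coordinate expression of a double map: the second component is \<open>1 / \<psi>(1/w)\<close> with
  the inner fractions cleared.\<close>

definition moebius_pair :: "complex \<Rightarrow> complex \<Rightarrow> complex \<Rightarrow> complex \<Rightarrow> complex \<times> complex \<Rightarrow> complex \<times> complex" where
  "moebius_pair A B C D q =
     ((A * fst q + B) / (C * fst q + D), (C + D * snd q) / (A + B * snd q))"

definition moebius_pair_domain :: "complex \<Rightarrow> complex \<Rightarrow> complex \<Rightarrow> complex \<Rightarrow> (complex \<times> complex) set" where
  "moebius_pair_domain A B C D = {q. C * fst q + D \<noteq> 0 \<and> A + B * snd q \<noteq> 0}"

lemma open_moebius_pair_domain: "open (moebius_pair_domain A B C D)"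
  unfolding moebius_pair_domain_def by (intro open_Collect_conj open_Collect_neq continuous_intros)

lemma double_map_emb:
  assumes "q \<in> moebius_pair_domain A B C D"
  shows "double_map (sphere_moebius A B C D) (emb q) = emb (moebius_pair A B C D q)"
proof -
  obtain z w where q: "q = (z, w)" by (cases q)
  have "sphere_inverse (sphere_moebius A B C D (sphere_inverse (Some w))) = Some ((C + D * w) / (A + B * w))"
    using assms fun_cong[OF sphere_moebius_inverse_right[of A B C D], of "Some w"]
    by (simp add: q moebius_pair_domain_def moebius_def add.commute)
  then show ?thesis using assms
    by (simp add: q double_map_def emb_def moebius_pair_def moebius_pair_domain_def moebius_def)
qed

text \<open>The determinant keeps numerator and denominator from vanishing together, so a zero
  denominator really sends the point out of the first chart.\<close>

lemma double_map_emb_finite: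
  assumes "A * D - B * C \<noteq> 0" "double_map (sphere_moebius A B C D) (emb q) = emb q'"
  shows "q \<in> moebius_pair_domain A B C D"
proof -
  obtain z w where q: "q = (z, w)" by (cases q)
  have 1: "C * z + D \<noteq> 0"
    using assms(2) by (auto simp: q double_map_def emb_def split: if_splits)
  have "A + B * w \<noteq> 0"
  proof
    assume 0: "A + B * w = 0"
    have "A * D - B * C = D * (A + B * w) - B * (C + D * w)" by (simp add: algebra_simps)
    then have "C + D * w \<noteq> 0" using 0 assms(1) by auto
    then have "sphere_moebius A B C D (sphere_inverse (Some w)) = Some 0"
      using 0 by (auto simp: moebius_def field_simps)
    then show False using assms(2) by (auto simp: q double_map_def emb_def)
  qed
  with 1 show ?thesis by (simp add: q moebius_pair_domain_def)
qed

lemma hol2_at_moebius_pair: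
  assumes "q \<in> moebius_pair_domain A B C D"
  shows "hol2_at (\<lambda>q. fst (moebius_pair A B C D q)) q" "hol2_at (\<lambda>q. snd (moebius_pair A B C D q)) q"
  using assms unfolding moebius_pair_def moebius_pair_domain_def
  by (auto intro!: hol2_at_intros)

text \<open>All that is needed of a group element near a point: a holomorphic coordinate expression
  \<open>G\<close> and the chain rule for the Laplacian.  By \<open>isometries_chart_flip\<close> only the first chart has to
  be considered on both sides.\<close>

lemma isometry_chart_form:
  assumes S: "S \<in> isometries" and q: "q \<in> coord_domain" "S (chart_inv c q) \<in> chart_domain d"
  obtains N G where "open N" "q \<in> N" "N \<subseteq> coord_domain"
    "\<forall>x\<in>N. G x \<in> coord_domain \<and> S (chart_inv c x) = chart_inv d (G x)"
    "\<forall>x\<in>N. hol2_at (\<lambda>x. fst (G x)) x \<and> hol2_at (\<lambda>x. snd (G x)) x"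
    "\<forall>f. (\<forall>x\<in>coord_domain. hol2_at f x) \<longrightarrow>
      (1 - fst q * snd q)\<^sup>2 * mixed (\<lambda>x. f (G x)) (fst q) (snd q)
      = (1 - fst (G q) * snd (G q))\<^sup>2 * mixed f (fst (G q)) (snd (G q))"
proof -
  let ?S = "chart_flip d \<circ> S \<circ> chart_flip c"
  obtain q' where q': "q' \<in> coord_domain" "S (chart_inv c q) = chart_flip d (emb q')"
    using q(2) by (auto simp: chart_domain_iff)
  then have fin: "?S (emb q) = emb q'" using q(1) by (simp add: chart_inv_eq)
  have conv: "y \<in> coord_domain \<and> S (chart_inv c x) = chart_inv d y"
    if x: "x \<in> coord_domain" and "?S (emb x) = emb y" for x y
  proof -
    have "?S (emb x) \<in> Omega"
      unfolding isometries_Omega_iff[OF isometries_chart_flip[OF S]] using that(1) by simp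
    then have "emb y \<in> Omega" unfolding that(2) .
    then have "y \<in> coord_domain" by simp
    moreover have "S (chart_inv c x) = chart_flip d (?S (emb x))" using x by (simp add: chart_inv_eq)
    ultimately show ?thesis using that(2) by (simp add: chart_inv_eq del: comp_apply)
  qed
  from isometries_cases[OF isometries_chart_flip[OF S, of d c]] show ?thesis
  proof cases
    case (1 A B C D)
    let ?G = "moebius_pair A B C D"
    let ?N = "coord_domain \<inter> moebius_pair_domain A B C D"
    have qN: "q \<in> ?N"
      using double_map_emb_finite[OF 1(1)] fin q(1) unfolding 1(2) by blast
    show ?thesis
    proof (rule that[of ?N ?G])
      show "open ?N" by (intro open_Int open_coord_domain open_moebius_pair_domain)
      show "\<forall>x\<in>?N. ?G x \<in> coord_domain \<and> S (chart_inv c x) = chart_inv d (?G x)"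
        by (intro ballI conv) (simp_all only: 1(2) double_map_emb Int_iff)
      show "\<forall>x\<in>?N. hol2_at (\<lambda>x. fst (?G x)) x \<and> hol2_at (\<lambda>x. snd (?G x)) x"
        using hol2_at_moebius_pair by blast
    next
      show "\<forall>f. (\<forall>x\<in>coord_domain. hol2_at f x) \<longrightarrow>
          (1 - fst q * snd q)\<^sup>2 * mixed (\<lambda>x. f (?G x)) (fst q) (snd q)
          = (1 - fst (?G q) * snd (?G q))\<^sup>2 * mixed f (fst (?G q)) (snd (?G q))"
      proof (intro allI impI)
        fix f assume f': "\<forall>x\<in>coord_domain. hol2_at f x"
        then have f: "\<And>x. x \<in> coord_domain \<Longrightarrow> hol2_at f x" by blast
        have "?G q \<in> coord_domain"
          using conv[of q "?G q"] qN by (simp only: 1(2) double_map_emb Int_iff)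
        then show "(1 - fst q * snd q)\<^sup>2 * mixed (\<lambda>x. f (?G x)) (fst q) (snd q)
            = (1 - fst (?G q) * snd (?G q))\<^sup>2 * mixed f (fst (?G q)) (snd (?G q))"
          using mixed_moebius[OF open_coord_domain _ f, of A "fst q" B C D "snd q"] qN
          by (simp add: moebius_pair_def moebius_pair_domain_def)
      qed
    qed (use qN in auto)
  next
    case (2 A B C D)
    let ?G = "\<lambda>x. moebius_pair A B C D (prod.swap x)"
    let ?N = "coord_domain \<inter> (\<lambda>x. (snd x, fst x)) -` moebius_pair_domain A B C D"
    have swap: "prod.swap (emb x) = emb (prod.swap x)" for x by (simp add: emb_def prod.swap_def)
    have N_iff: "x \<in> ?N \<longleftrightarrow> x \<in> coord_domain \<and> prod.swap x \<in> moebius_pair_domain A B C D" for x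
      by (simp add: prod.swap_def)
    have qN: "q \<in> ?N"
      using double_map_emb_finite[OF 2(1), of "prod.swap q"] fin q(1)
      unfolding 2(2) N_iff by (simp add: swap)
    have rep: "?S (emb x) = emb (?G x)" if "x \<in> ?N" for x
      using that double_map_emb unfolding N_iff 2(2) by (simp add: swap)
    show ?thesis
    proof (rule that[of ?N ?G])
      show "open ?N" by (intro open_Int open_coord_domain open_swap open_moebius_pair_domain)
      show "\<forall>x\<in>?N. ?G x \<in> coord_domain \<and> S (chart_inv c x) = chart_inv d (?G x)"
        by (intro ballI conv[OF _ rep]) auto
      show "\<forall>x\<in>?N. hol2_at (\<lambda>x. fst (?G x)) x \<and> hol2_at (\<lambda>x. snd (?G x)) x"
      proof
        fix x assume x: "x \<in> ?N"
        have "hol2_at (\<lambda>y. fst (moebius_pair A B C D y)) (snd x, fst x)"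
          "hol2_at (\<lambda>y. snd (moebius_pair A B C D y)) (snd x, fst x)"
          using x hol2_at_moebius_pair by simp_all
        from this[THEN hol2_at_swap] show "hol2_at (\<lambda>x. fst (?G x)) x \<and> hol2_at (\<lambda>x. snd (?G x)) x"
          by (simp add: prod.swap_def)
      qed
    next
      show "\<forall>f. (\<forall>x\<in>coord_domain. hol2_at f x) \<longrightarrow>
          (1 - fst q * snd q)\<^sup>2 * mixed (\<lambda>x. f (?G x)) (fst q) (snd q)
          = (1 - fst (?G q) * snd (?G q))\<^sup>2 * mixed f (fst (?G q)) (snd (?G q))"
      proof (intro allI impI)
        fix f assume f': "\<forall>x\<in>coord_domain. hol2_at f x"
        then have f: "\<And>x. x \<in> coord_domain \<Longrightarrow> hol2_at f x" by blast
        let ?h = "\<lambda>x. f (moebius_pair A B C D x)"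
        obtain z w where zw: "q = (z, w)" by (cases q)
        have Gq: "?G q \<in> coord_domain" using conv[OF q(1) rep[OF qN]] by blast
        have hh: "hol2_at ?h x" if "x \<in> moebius_pair_domain A B C D \<inter> prod.swap -` ?N" for x
        proof -
          have "?G (prod.swap x) \<in> coord_domain"
            using that conv[OF _ rep[of "prod.swap x"]] by auto
          then have "hol2_at f (fst (moebius_pair A B C D x), snd (moebius_pair A B C D x))"
            using f by simp
          from hol2_at_chain[where f = f and a = "\<lambda>y. fst (moebius_pair A B C D y)"
                and b = "\<lambda>y. snd (moebius_pair A B C D y)", OF this] hol2_at_moebius_pair that
          show ?thesis by simp
        qed
        have op: "open (moebius_pair_domain A B C D \<inter> prod.swap -` ?N)"
          unfolding prod.swap_def
          by (intro open_Int open_coord_domain open_swap open_moebius_pair_domain)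
        have "mixed (\<lambda>x. f (?G x)) z w = mixed ?h w z"
          using mixed_swap[OF op _ hh, of w z] qN unfolding N_iff zw by (simp add: prod.swap_def)
        moreover have "(1 - w * z)\<^sup>2 * mixed ?h w z
            = (1 - fst (?G q) * snd (?G q))\<^sup>2 * mixed f (fst (?G q)) (snd (?G q))"
          using mixed_moebius[OF open_coord_domain _ f, of A w B C D z] qN Gq
          unfolding N_iff zw by (simp add: moebius_pair_def moebius_pair_domain_def)
        ultimately show "(1 - fst q * snd q)\<^sup>2 * mixed (\<lambda>x. f (?G x)) (fst q) (snd q)
            = (1 - fst (?G q) * snd (?G q))\<^sup>2 * mixed f (fst (?G q)) (snd (?G q))"
          by (simp add: zw mult.commute)
      qed
    qed (use qN in auto)
  qed
qed

lemma continuous_map_isometry: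
  assumes S: "S \<in> isometries"
  shows "continuous_map Omega_topology Omega_topology S"
proof -
  have "openin Omega_topology {p \<in> Omega. S p \<in> V}" if V: "openin Omega_topology V" for V
  proof (subst openin_subopen, intro ballI)
    fix p assume p: "p \<in> {p \<in> Omega. S p \<in> V}"
    then obtain c q where q: "q \<in> coord_domain" "p = chart_inv c q" using chart_cover by blast
    have "S p \<in> Omega" using p isometries_Omega_iff[OF S] by blast
    then obtain d y where y: "y \<in> coord_domain" "S p = chart_inv d y" by (rule chart_cover)
    then have "S (chart_inv c q) \<in> chart_domain d" using q by simp
    then obtain N G where N: "open N" "q \<in> N" "N \<subseteq> coord_domain"
      and G: "\<forall>x\<in>N. G x \<in> coord_domain \<and> S (chart_inv c x) = chart_inv d (G x)"
      and hol: "\<forall>x\<in>N. hol2_at (\<lambda>x. fst (G x)) x \<and> hol2_at (\<lambda>x. snd (G x)) x"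
      by (rule isometry_chart_form[OF S q(1)])
    have "isCont (\<lambda>x. (fst (G x), snd (G x))) x" if "x \<in> N" for x
      using hol that hol2_at_isCont by (intro continuous_Pair) auto
    then have "continuous_on N G" by (intro continuous_at_imp_continuous_on) simp
    then have o: "open (N \<inter> G -` {x \<in> coord_domain. chart_inv d x \<in> V})"
      using N(1) open_chart_preimage[OF V] by (rule continuous_open_preimage)
    let ?M = "N \<inter> G -` {x \<in> coord_domain. chart_inv d x \<in> V}"
    have "openin Omega_topology (chart_inv c ` ?M)"
      using o N(3) by (intro openin_chart_inv_image) auto
    moreover have "chart_inv c ` ?M \<subseteq> {p \<in> Omega. S p \<in> V}"
      using N(3) G by auto
    moreover have "p \<in> chart_inv c ` ?M"
      using p q N(2) G by auto
    ultimately show "\<exists>T. openin Omega_topology T \<and> p \<in> T \<and> T \<subseteq> {p \<in> Omega. S p \<in> V}"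
      by blast
  qed
  then show ?thesis
    using isometries_Omega_iff[OF S] by (auto simp: continuous_map_def)
qed

lemma holomorphic_mapping_isometry:
  assumes S: "S \<in> isometries" and T: "\<And>p. p \<in> Omega \<Longrightarrow> T p = S p"
  shows "holomorphic_mapping Omega T"
  unfolding holomorphic_mapping_def Let_def holomorphic2_on_iff
proof (intro conjI allI ballI)
  have "subtopology Omega_topology Omega = Omega_topology"
    by (metis subtopology_topspace topspace_Omega)
  then show "continuous_map (subtopology Omega_topology Omega) Omega_topology T"
    using continuous_map_eq[OF continuous_map_isometry[OF S]] T by simp
  fix c d q assume q: "q \<in> chart_map c ` (Omega \<inter> chart_domain c \<inter> T -` chart_domain d)"
  have "chart_map c ` (Omega \<inter> chart_domain c \<inter> T -` chart_domain d)
     = {x \<in> coord_domain. chart_inv c x \<in> Omega \<inter> T -` chart_domain d}"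
    unfolding chart_image[symmetric] by (simp add: Int_ac)
  with q have "q \<in> coord_domain" "T (chart_inv c q) \<in> chart_domain d" by auto
  then have q: "q \<in> coord_domain" "S (chart_inv c q) \<in> chart_domain d"
    using T[of "chart_inv c q"] by simp_all
  obtain N G where N: "open N" "q \<in> N" "N \<subseteq> coord_domain"
      and G: "\<forall>x\<in>N. G x \<in> coord_domain \<and> S (chart_inv c x) = chart_inv d (G x)"
      and hol: "\<forall>x\<in>N. hol2_at (\<lambda>x. fst (G x)) x \<and> hol2_at (\<lambda>x. snd (G x)) x"
    by (rule isometry_chart_form[OF S q])
  have eq: "G x = (chart_map d \<circ> T \<circ> chart_inv c) x" if "x \<in> N" for x
  proof -
    have x: "x \<in> coord_domain" "G x \<in> coord_domain" "S (chart_inv c x) = chart_inv d (G x)"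
      using that N(3) G by auto
    then have "T (chart_inv c x) = chart_inv d (G x)" using T[of "chart_inv c x"] by simp
    then show ?thesis using x by simp
  qed
  show "hol2_at (fst \<circ> (chart_map d \<circ> T \<circ> chart_inv c)) q"
    by (rule hol2_at_cong[where f = "\<lambda>x. fst (G x)", OF _ N(1,2)]) (use hol N(2) eq in auto)
  show "hol2_at (snd \<circ> (chart_map d \<circ> T \<circ> chart_inv c)) q"
    by (rule hol2_at_cong[where f = "\<lambda>x. snd (G x)", OF _ N(1,2)]) (use hol N(2) eq in auto)
qed

text \<open>The inverse of an element has the same form, so biholomorphy follows
  from holomorphy of all elements.\<close>

lemma isometries_subset_moebius_group: "isometries \<subseteq> moebius_group"
proof
  fix S assume S: "S \<in> isometries"
  obtain S' where S': "S' \<in> isometries" "\<forall>p. S' (S p) = p" "\<forall>p. S (S' p) = p"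
    by (rule isometries_inverse[OF S])
  have bij: "bij_betw S Omega Omega"
    by (rule bij_betw_byWitness[where f' = S'])
       (use S' isometries_Omega_iff[OF S] isometries_Omega_iff[OF S'(1)] in auto)
  have "inv_into Omega S p = S' p" if "p \<in> Omega" for p
    by (rule inv_into_f_eq)
       (use that bij isometries_Omega_iff[OF S'(1)] in \<open>simp_all only: bij_betw_def S'(3)\<close>)
  then have "biholomorphic_self_map S"
    unfolding biholomorphic_self_map_def
    using bij holomorphic_mapping_isometry[OF S] holomorphic_mapping_isometry[OF S'(1)] by auto
  moreover have "\<exists>\<psi>\<in>Aut_sphere.
            (\<forall>(z, w)\<in>Omega. S (z, w) = (\<psi> z, sphere_inverse (\<psi> (sphere_inverse w)))) \<or>
            (\<forall>(z, w)\<in>Omega. S (z, w) = (\<psi> w, sphere_inverse (\<psi> (sphere_inverse z))))"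
    using S unfolding isometries_def double_map_def by fastforce
  ultimately show "S \<in> moebius_group" unfolding moebius_group_def by blast
qed

lemma moebius_group_isometry:
  assumes "S \<in> moebius_group"
  obtains S' where "S' \<in> isometries" "\<forall>p\<in>Omega. S p = S' p"
proof -
  obtain \<psi> where \<psi>: "\<psi> \<in> Aut_sphere"
    and "(\<forall>(z, w)\<in>Omega. S (z, w) = (\<psi> z, sphere_inverse (\<psi> (sphere_inverse w)))) \<or>
            (\<forall>(z, w)\<in>Omega. S (z, w) = (\<psi> w, sphere_inverse (\<psi> (sphere_inverse z))))"
    using assms unfolding moebius_group_def by blast
  then consider "\<forall>p\<in>Omega. S p = double_map \<psi> p" | "\<forall>p\<in>Omega. S p = (double_map \<psi> \<circ> prod.swap) p"
    by (auto simp: double_map_def case_prod_beta)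
  then show ?thesis
  proof cases
    case 1
    then show ?thesis using \<psi> by (intro that[of "double_map \<psi>"]) (auto simp: isometries_def)
  next
    case 2
    then show ?thesis
      using \<psi> by (intro that[of "double_map \<psi> \<circ> prod.swap"]) (auto simp: isometries_def)
  qed
qed

section \<open>An element of the group is determined by its values near a point\<close>

text \<open>Cross-multiplication gives a polynomial of degree at most two with infinitely many
  roots.  Its leading coefficient also settles the value at infinity.\<close>

lemma sphere_moebius_eqI:
  assumes det: "A * D - B * C \<noteq> 0" "A' * D' - B' * C' \<noteq> 0"
    and X: "infinite X" and eq: "\<And>z. z \<in> X \<Longrightarrow> sphere_moebius A B C D (Some z) = sphere_moebius A' B' C' D' (Some z)"
  shows "sphere_moebius A B C D = sphere_moebius A' B' C' D'"
proof -
  \<comment> \<open>The expanded difference of the two cross products.\<close>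
  define p where "p = [:B * D' - B' * D, A * D' + B * C' - A' * D - B' * C, A * C' - A' * C:]"
  have p: "poly p z = (A * z + B) * (C' * z + D') - (A' * z + B') * (C * z + D)" for z
    by (simp add: p_def algebra_simps)
  have nz: "\<not> (C * z + D = 0 \<and> A * z + B = 0)" "\<not> (C' * z + D' = 0 \<and> A' * z + B' = 0)" for z
  proof -
    have "A * D - B * C = A * (C * z + D) - C * (A * z + B)"
      "A' * D' - B' * C' = A' * (C' * z + D') - C' * (A' * z + B')" by (simp_all add: algebra_simps)
    then show "\<not> (C * z + D = 0 \<and> A * z + B = 0)" "\<not> (C' * z + D' = 0 \<and> A' * z + B' = 0)"
      using det by auto
  qed
  have "X \<subseteq> {z. poly p z = 0}"
  proof
    fix z assume "z \<in> X"
    from eq[OF this] show "z \<in> {z. poly p z = 0}"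
      by (auto simp: p moebius_def frac_eq_eq split: if_splits)
  qed
  then have "p = 0" using X poly_roots_finite finite_subset by blast
  then have 0: "(A * z + B) * (C' * z + D') = (A' * z + B') * (C * z + D)" for z
    using p[of z] by simp
  have AC: "A * C' = A' * C" using \<open>p = 0\<close> by (simp add: p_def)
  show ?thesis
  proof
    fix x show "sphere_moebius A B C D x = sphere_moebius A' B' C' D' x"
    proof (cases x)
      case None
      then show ?thesis using AC det by (auto simp: frac_eq_eq)
    next
      case (Some z)
      have "C * z + D = 0 \<longleftrightarrow> C' * z + D' = 0" using 0[of z] nz[of z] by auto
      then show ?thesis using Some 0[of z] by (auto simp: moebius_def frac_eq_eq)
    qed
  qed
qed

text \<open>A plain and a swapped double map cannot agree on a bidisc: a first component
  depending both on \<open>z\<close> alone and on \<open>w\<close> alone would be constant, and \<open>\<psi>\<close> is injective.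
  Two maps of the same kind are compared by \<open>sphere_moebius_eqI\<close>.\<close>

lemma isometries_eqI:
  assumes S: "S \<in> isometries" "S' \<in> isometries"
    and V: "openin Omega_topology V" "V \<noteq> {}" and eq: "\<And>p. p \<in> V \<Longrightarrow> S p = S' p"
  shows "S = S'"
proof -
  obtain p where p: "p \<in> V" using V(2) by blast
  then have "p \<in> Omega" using V(1) openin_subset by fastforce
  then obtain c q where q: "q \<in> coord_domain" "p = chart_inv c q" by (rule chart_cover)
  obtain z0 w0 where zw: "q = (z0, w0)" by (cases q)
  obtain r where r: "r > 0" "ball z0 r \<times> ball w0 r \<subseteq> {q \<in> coord_domain. chart_inv c q \<in> V}"
    using open_contains_polydisc[OF open_chart_preimage[OF V(1), of c], of z0 w0] q p zw by blast
  define R R' where "R = chart_flip Plus \<circ> S \<circ> chart_flip c" and "R' = chart_flip Plus \<circ> S' \<circ> chart_flip c"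
  have RR: "R \<in> isometries" "R' \<in> isometries"
    using S isometries_chart_flip unfolding R_def R'_def by blast+
  have agree: "R (emb (z, w)) = R' (emb (z, w))" if "z \<in> ball z0 r" "w \<in> ball w0 r" for z w
  proof -
    have "(z, w) \<in> {q \<in> coord_domain. chart_inv c q \<in> V}" using that r(2) by blast
    then have "(z, w) \<in> coord_domain" "chart_inv c (z, w) \<in> V" by simp_all
    then have "S (chart_flip c (emb (z, w))) = S' (chart_flip c (emb (z, w)))"
      using eq[of "chart_flip c (emb (z, w))"] by (simp add: chart_inv_eq)
    then show ?thesis by (simp add: R_def R'_def)
  qed
  have inf: "infinite (ball x r)" for x :: complex
    using uncountable_ball[OF r(1)] countable_finite by blast
  have zc: "z0 \<in> ball z0 r" "w0 \<in> ball w0 r" using r(1) by auto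
  obtain u where u: "u \<in> ball z0 r" "u \<noteq> z0"
    using inf[of z0] finite_subset[of "ball z0 r" "{z0}"] by blast
  have no_mix: False if Aut: "\<psi> \<in> Aut_sphere" and
    "\<And>z w. z \<in> ball z0 r \<Longrightarrow> w \<in> ball w0 r \<Longrightarrow> \<psi> (Some z) = \<phi> (Some w)" for \<psi> \<phi>
  proof -
    have "\<psi> (Some u) = \<psi> (Some z0)" using that(2)[OF u(1) zc(2)] that(2)[OF zc] by simp
    moreover obtain \<psi>' where "\<forall>x. \<psi>' (\<psi> x) = x" by (rule Aut_sphere_inverse[OF Aut])
    ultimately have "Some u = Some z0" by metis
    then show False using u(2) by simp
  qed
  have "R = R'"
  proof (rule isometries_cases[OF RR(1)]; rule isometries_cases[OF RR(2)])
    fix A B C D A' B' C' D' :: complex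
    assume d: "A * D - B * C \<noteq> 0" "A' * D' - B' * C' \<noteq> 0"
    let ?\<psi> = "sphere_moebius A B C D" and ?\<phi> = "sphere_moebius A' B' C' D'"
    have Aut: "?\<psi> \<in> Aut_sphere" "?\<phi> \<in> Aut_sphere" using d sphere_moebius_in_Aut by blast+
    { assume *: "R = double_map ?\<psi>" "R' = double_map ?\<phi>"
      have "?\<psi> = ?\<phi>"
        by (rule sphere_moebius_eqI[OF d inf[of z0]])
           (use agree[OF _ zc(2)] in \<open>simp add: * double_map_def emb_def\<close>)
      then show "R = R'" using * by simp }
    { assume *: "R = double_map ?\<psi> \<circ> prod.swap" "R' = double_map ?\<phi> \<circ> prod.swap"
      have "?\<psi> = ?\<phi>"
        by (rule sphere_moebius_eqI[OF d inf[of w0]])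
           (use agree[OF zc(1)] in \<open>simp add: * double_map_def emb_def\<close>)
      then show "R = R'" using * by simp }
    { assume *: "R = double_map ?\<psi>" "R' = double_map ?\<phi> \<circ> prod.swap"
      show "R = R'"
        using no_mix[OF Aut(1), of ?\<phi>] agree by (simp add: * double_map_def emb_def) }
    { assume *: "R = double_map ?\<psi> \<circ> prod.swap" "R' = double_map ?\<phi>"
      show "R = R'"
        using no_mix[OF Aut(2), of ?\<psi>] agree by (simp add: * double_map_def emb_def) }
  qed
  then have "S \<circ> chart_flip c = S' \<circ> chart_flip c" by (simp add: R_def R'_def chart_flip_def)
  then have "S (chart_flip c (chart_flip c p)) = S' (chart_flip c (chart_flip c p))" for p by (metis comp_apply)
  then show ?thesis by (simp add: fun_eq_iff)
qed

section \<open>Enough global holomorphic functions\<close>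

text \<open>\<open>f\<close> and \<open>g\<close> are the expressions in the first and second chart of one holomorphic function
  on \<open>\<Omega>\<close>.\<close>

definition chart_expressions :: "(complex \<times> complex \<Rightarrow> complex) \<Rightarrow> (complex \<times> complex \<Rightarrow> complex) \<Rightarrow> bool" where
  "chart_expressions f g \<longleftrightarrow> (\<forall>q\<in>coord_domain. hol2_at f q \<and> hol2_at g q) \<and>
     (\<forall>z w. z \<noteq> 0 \<longrightarrow> w \<noteq> 0 \<longrightarrow> z * w \<noteq> 1 \<longrightarrow> g (z, w) = f (1 / w, 1 / z))"

lemma chart_expressions_sym:
  assumes "chart_expressions f g" shows "chart_expressions g f"
proof -
  have "f (z, w) = g (1 / w, 1 / z)" if "z \<noteq> 0" "w \<noteq> 0" "z * w \<noteq> 1" for z w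
  proof -
    have "1 / w * (1 / z) \<noteq> 1" using that by (simp add: field_simps)
    then show ?thesis using assms that by (simp add: chart_expressions_def)
  qed
  then show ?thesis using assms by (auto simp: chart_expressions_def)
qed

lemma chart_expressions_mult:
  "chart_expressions f g \<Longrightarrow> chart_expressions f' g' \<Longrightarrow> chart_expressions (\<lambda>q. f q * f' q) (\<lambda>q. g q * g' q)"
  by (auto simp: chart_expressions_def intro: hol2_at_mult)

text \<open>Without the denominator the coordinates have poles at infinity.  Under
  \<open>(z, w) \<mapsto> (1/w, 1/z)\<close> the factor \<open>1 / (1 - z w)\<close> becomes \<open>z w / (z w - 1)\<close>, whose zeros cancel
  them.\<close>

lemma chart_expressions_linear:
  "chart_expressions (\<lambda>q. (fst q - a) * (1 / (1 - fst q * snd q))) (\<lambda>q. fst q * (1 - a * snd q) / (fst q * snd q - 1))"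
  "chart_expressions (\<lambda>q. (snd q - a) * (1 / (1 - fst q * snd q))) (\<lambda>q. snd q * (1 - a * fst q) / (fst q * snd q - 1))"
proof -
  have h: "hol2_at (\<lambda>q. l q * (1 / (1 - fst q * snd q))) q" "hol2_at (\<lambda>q. l q / (fst q * snd q - 1)) q"
    if "q \<in> coord_domain" "hol2_at l q" for l q
    using that by (auto intro!: hol2_at_intros simp: coord_domain_def)
  have l: "hol2_at (\<lambda>q. fst q - a) q" "hol2_at (\<lambda>q. snd q - a) q"
    "hol2_at (\<lambda>q. fst q * (1 - a * snd q)) q" "hol2_at (\<lambda>q. snd q * (1 - a * fst q)) q" for q
    by (intro hol2_at_intros)+
  have e: "z * (1 - a * w) / (z * w - 1) = (1 / w - a) * (1 / (1 - 1 / w * (1 / z)))"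
    if "z \<noteq> 0" "w \<noteq> 0" "z * w \<noteq> 1" for z w :: complex
  proof -
    have "1 - 1 / w * (1 / z) = (z * w - 1) / (z * w)" "1 / w - a = (1 - a * w) / w"
      using that by (simp_all add: field_simps)
    then show ?thesis using that by (simp add: field_simps)
  qed
  have e': "w * (1 - a * z) / (z * w - 1) = (1 / z - a) * (1 / (1 - 1 / w * (1 / z)))"
    if "z \<noteq> 0" "w \<noteq> 0" "z * w \<noteq> 1" for z w :: complex
    using e[of w z] that by (simp add: mult.commute)
  show "chart_expressions (\<lambda>q. (fst q - a) * (1 / (1 - fst q * snd q))) (\<lambda>q. fst q * (1 - a * snd q) / (fst q * snd q - 1))"
    unfolding chart_expressions_def using h(1)[OF _ l(1)] h(2)[OF _ l(3)] e by simp
  show "chart_expressions (\<lambda>q. (snd q - a) * (1 / (1 - fst q * snd q))) (\<lambda>q. snd q * (1 - a * fst q) / (fst q * snd q - 1))"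
    unfolding chart_expressions_def using h(1)[OF _ l(2)] h(2)[OF _ l(4)] e' by simp
qed

lemma chart_expressions_global:
  assumes "chart_expressions f g"
  shows "\<exists>F\<in>holomorphic_functions Omega.
     (\<forall>q\<in>coord_domain. F (chart_inv Plus q) = f q \<and> F (chart_inv Minus q) = g q)"
proof -
  define F where "F p = (if p \<in> chart_domain Plus then f (chart_map Plus p) else g (chart_map Minus p))" for p
  have P: "F (chart_inv Plus q) = f q" if "q \<in> coord_domain" for q
    using that by (simp add: F_def)
  have M: "F (chart_inv Minus q) = g q" if q: "q \<in> coord_domain" for q
  proof (cases "chart_inv Minus q \<in> chart_domain Plus")
    case False
    then show ?thesis using q by (simp add: F_def)
  next
    case True
    obtain z w where zw: "q = (z, w)" by (cases q)
    have ne: "z \<noteq> 0" "w \<noteq> 0" "z * w \<noteq> 1"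
      using True q by (auto simp: zw chart_domain.simps chart_inv_eq chart_flip_def recip_swap_def emb_def coord_domain_def)
    have "chart_map Plus (chart_inv Minus q) = (1 / w, 1 / z)"
      using ne q by (simp add: zw chart_inv_eq chart_flip_def recip_swap_def emb_def chart_map.simps)
    then show ?thesis using assms ne True by (simp add: F_def chart_expressions_def zw)
  qed
  have "F \<in> holomorphic_functions Omega"
    unfolding holomorphic_functions_Omega_iff
  proof (intro allI ballI)
    fix c q assume q: "q \<in> coord_domain"
    show "hol2_at (F \<circ> chart_inv c) q"
    proof (cases c)
      case Plus
      show ?thesis
        by (rule hol2_at_cong[where f = f, OF _ open_coord_domain q]) (use assms q P Plus in \<open>auto simp: chart_expressions_def\<close>)
    next
      case Minus
      show ?thesis
        by (rule hol2_at_cong[where f = g, OF _ open_coord_domain q]) (use assms q M Minus in \<open>auto simp: chart_expressions_def\<close>)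
    qed
  qed
  then show ?thesis using P M by blast
qed

text \<open>The relation between chart expressions is symmetric, so a function with a prescribed
  expression in the second chart is as easy to get as one in the first.\<close>

lemma test_function_exists:
  assumes "l \<in> {\<lambda>q. fst q - a, \<lambda>q. snd q - b}" "m \<in> {\<lambda>q. fst q - a, \<lambda>q. snd q - b}"
  shows "\<exists>F\<in>holomorphic_functions Omega.
     \<forall>q\<in>coord_domain. F (chart_inv d q) = l q * m q * (1 / (1 - fst q * snd q)\<^sup>2)"
proof -
  have "\<exists>g. chart_expressions (\<lambda>q. l q * (1 / (1 - fst q * snd q))) g"
    "\<exists>g. chart_expressions (\<lambda>q. m q * (1 / (1 - fst q * snd q))) g"
    using assms chart_expressions_linear by blast+
  then obtain g h where gh: "chart_expressions (\<lambda>q. l q * (1 / (1 - fst q * snd q))) g"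
    "chart_expressions (\<lambda>q. m q * (1 / (1 - fst q * snd q))) h" by blast
  let ?f = "\<lambda>q. l q * (1 / (1 - fst q * snd q)) * (m q * (1 / (1 - fst q * snd q)))"
  have "chart_expressions ?f (\<lambda>q. g q * h q)" by (rule chart_expressions_mult[OF gh])
  then have "\<exists>F\<in>holomorphic_functions Omega. \<forall>q\<in>coord_domain. F (chart_inv d q) = ?f q"
    using chart_expressions_global chart_expressions_sym by (cases d) blast+
  then show ?thesis by (simp add: power2_eq_square mult_ac)
qed

section \<open>Invariance of the Laplacian and the group\<close>

text \<open>This is the chain rule of \<open>isometry_chart_form\<close> in charts around \<open>p\<close> and \<open>S p\<close>; both sides depend
  only on germs, so \<open>T\<close> may be any extension of \<open>S\<close> from the open set \<open>U\<close>.\<close>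

lemma laplacian_comp_isometry:
  assumes S: "S \<in> isometries" and U: "openin Omega_topology U" and TS: "\<And>p. p \<in> U \<Longrightarrow> T p = S p"
    and F: "F \<in> holomorphic_functions Omega" and p: "p \<in> U"
  shows "laplacian (F \<circ> T) p = laplacian F (T p)"
proof -
  have pO: "p \<in> Omega" using U p openin_subset by fastforce
  then obtain c q where q: "q \<in> coord_domain" "p = chart_inv c q" by (rule chart_cover)
  have "S p \<in> Omega" using pO isometries_Omega_iff[OF S] by blast
  then obtain d y where y: "y \<in> coord_domain" "S p = chart_inv d y" by (rule chart_cover)
  then have "S (chart_inv c q) \<in> chart_domain d" using q by simp
  then obtain N G where N: "open N" "q \<in> N" "N \<subseteq> coord_domain"
    and G: "\<forall>x\<in>N. G x \<in> coord_domain \<and> S (chart_inv c x) = chart_inv d (G x)"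
    and hol: "\<forall>x\<in>N. hol2_at (\<lambda>x. fst (G x)) x \<and> hol2_at (\<lambda>x. snd (G x)) x"
    and inv: "\<forall>f. (\<forall>x\<in>coord_domain. hol2_at f x) \<longrightarrow>
      (1 - fst q * snd q)\<^sup>2 * mixed (\<lambda>x. f (G x)) (fst q) (snd q)
      = (1 - fst (G q) * snd (G q))\<^sup>2 * mixed f (fst (G q)) (snd (G q))"
    by (rule isometry_chart_form[OF S q(1)])
  let ?f = "F \<circ> chart_inv d"
  have f: "\<forall>x\<in>coord_domain. hol2_at ?f x"
    using F unfolding holomorphic_functions_Omega_iff by blast
  define N' where "N' = N \<inter> {x \<in> coord_domain. chart_inv c x \<in> U}"
  have N': "open N'" "q \<in> N'" "N' \<subseteq> coord_domain"
    using N open_chart_preimage[OF U] p q unfolding N'_def by auto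
  have eq: "(F \<circ> T \<circ> chart_inv c) x = ?f (G x)" if "x \<in> N'" for x
    using that G TS[of "chart_inv c x"] by (simp add: N'_def)
  have "hol2_at (F \<circ> T \<circ> chart_inv c) x" if x: "x \<in> N'" for x
  proof (rule hol2_at_cong[OF _ N'(1) x])
    have "x \<in> N" using x by (simp add: N'_def)
    then show "hol2_at (\<lambda>x. ?f (fst (G x), snd (G x))) x"
      using hol2_at_chain[where f = ?f and a = "\<lambda>x. fst (G x)" and b = "\<lambda>x. snd (G x)" and p = x]
        f G hol by simp
  qed (use eq in simp)
  then have "laplacian (F \<circ> T) (chart_inv c (fst q, snd q)) =
      4 * ((1 - fst q * snd q)\<^sup>2 * mixed (F \<circ> T \<circ> chart_inv c) (fst q) (snd q))"
    using N' by (intro laplacian_chart_inv[of N']) auto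
  also have "mixed (F \<circ> T \<circ> chart_inv c) (fst q) (snd q) = mixed (\<lambda>x. ?f (G x)) (fst q) (snd q)"
    by (rule mixed_cong[OF N'(1)]) (use N'(2) eq in auto)
  also have "(1 - fst q * snd q)\<^sup>2 * \<dots> = (1 - fst (G q) * snd (G q))\<^sup>2 * mixed ?f (fst (G q)) (snd (G q))"
    using inv f by blast
  also have "4 * \<dots> = laplacian F (chart_inv d (fst (G q), snd (G q)))"
    by (rule laplacian_chart_inv[OF open_coord_domain _ _ bspec[OF f], symmetric]) (use G N in auto)
  also have "chart_inv d (fst (G q), snd (G q)) = T p"
    using G N(2) TS[OF p] q by simp
  finally show ?thesis using q(2) by (simp only: prod.collapse)
qed

text \<open>In charts around \<open>p\<close> and \<open>T p\<close> the hypothesis, applied to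
  the test functions, yields the conformal equations for the coordinate expression of \<open>T\<close>, and
  \<open>local_isometry_is_moebius\<close> solves them.\<close>

lemma laplacian_invariant_imp_locally_isometry:
  assumes U: "openin Omega_topology U" and T: "holomorphic_mapping U T"
    and inv: "\<And>F p. F \<in> holomorphic_functions Omega \<Longrightarrow> p \<in> U \<Longrightarrow> laplacian (F \<circ> T) p = laplacian F (T p)"
    and p: "p \<in> U"
  obtains V S where "openin Omega_topology V" "p \<in> V" "V \<subseteq> U" "S \<in> isometries" "\<forall>x\<in>V. T x = S x"
proof -
  have UO: "U \<subseteq> Omega" using openin_subset[OF U] by simp
  have cont: "continuous_map (subtopology Omega_topology U) Omega_topology T"
    using T by (simp add: holomorphic_mapping_def)
  have TO: "T x \<in> Omega" if "x \<in> U" for x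
    using continuous_map_image_subset_topspace[OF cont] that UO by auto
  obtain c q where q: "q \<in> coord_domain" "p = chart_inv c q" using chart_cover p UO by blast
  obtain d y where y: "y \<in> coord_domain" "T p = chart_inv d y" using chart_cover[OF TO[OF p]] by blast
  have "openin (subtopology Omega_topology U) {x \<in> U. T x \<in> chart_domain d}"
    using openin_continuous_map_preimage[OF cont openin_chart_domain[of d]] UO
    by (simp add: Int_absorb1)
  then have oU: "openin Omega_topology {x \<in> U. T x \<in> chart_domain d}"
    using U openin_trans_full by blast
  define M where "M = {x \<in> coord_domain. chart_inv c x \<in> {x \<in> U. T x \<in> chart_domain d}}"
  have M: "open M" "q \<in> M" "M \<subseteq> coord_domain"
    using open_chart_preimage[OF oU] p q y by (auto simp: M_def)
  let ?G = "chart_map d \<circ> T \<circ> chart_inv c"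
  define a b where "a = fst \<circ> ?G" and "b = snd \<circ> ?G"
  have "chart_map c ` (U \<inter> chart_domain c \<inter> T -` chart_domain d) = M"
  proof -
    have "U \<inter> chart_domain c \<inter> T -` chart_domain d = {x \<in> U. T x \<in> chart_domain d} \<inter> chart_domain c"
      by auto
    then show ?thesis by (simp only: chart_image M_def)
  qed
  then have "holomorphic2_on a M" "holomorphic2_on b M"
    using T unfolding holomorphic_mapping_def Let_def a_def b_def by metis+
  then have ab: "hol2_at a x" "hol2_at b x" if "x \<in> M" for x
    using that by (auto simp: holomorphic2_on_iff)
  have Gin: "(a x, b x) \<in> coord_domain" "T (chart_inv c x) = chart_inv d (a x, b x)" if "x \<in> M" for x
    using that chart_map_in[of "T (chart_inv c x)" d] by (simp_all add: M_def a_def b_def)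
  have ne: "a x * b x \<noteq> 1" if "x \<in> M" for x using Gin(1)[OF that] by (simp add: coord_domain_def)
  have eqs: "dz a z w * dw a z w = 0" "dz b z w * dw b z w = 0"
    "(1 - z * w)\<^sup>2 * (dz a z w * dw b z w + dw a z w * dz b z w) = (1 - a (z, w) * b (z, w))\<^sup>2"
    if zw: "(z, w) \<in> M" for z w
  proof -
    have key: "(1 - z * w)\<^sup>2 * mixed (\<lambda>x. l (a x, b x) * m (a x, b x) * (1 / (1 - a x * b x)\<^sup>2)) z w
       = (1 - a (z, w) * b (z, w))\<^sup>2 *
         mixed (\<lambda>q. l q * m q * (1 / (1 - fst q * snd q)\<^sup>2)) (a (z, w)) (b (z, w))"
      if lm: "l \<in> {\<lambda>q. fst q - a (z, w), \<lambda>q. snd q - b (z, w)}"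
         "m \<in> {\<lambda>q. fst q - a (z, w), \<lambda>q. snd q - b (z, w)}" for l m
    proof -
      let ?f = "\<lambda>q. l q * m q * (1 / (1 - fst q * snd q)\<^sup>2)"
      obtain F where F: "F \<in> holomorphic_functions Omega"
        and Ff: "\<forall>q\<in>coord_domain. F (chart_inv d q) = ?f q"
        using test_function_exists[OF lm, of d] by blast
      have f: "hol2_at (F \<circ> chart_inv d) x" if "x \<in> coord_domain" for x
        using F that unfolding holomorphic_functions_Omega_iff by blast
      have eq: "(F \<circ> T \<circ> chart_inv c) x = (F \<circ> chart_inv d) (a x, b x)" if "x \<in> M" for x
        using Gin(2)[OF that] by simp
      have h: "hol2_at (F \<circ> T \<circ> chart_inv c) x" if x: "x \<in> M" for x
        by (rule hol2_at_cong[OF hol2_at_chain[where a = a and b = b, OF f ab] M(1) x])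
           (use Gin(1) x eq in auto)
      have "4 * ((1 - z * w)\<^sup>2 * mixed (F \<circ> T \<circ> chart_inv c) z w) = laplacian (F \<circ> T) (chart_inv c (z, w))"
        by (rule laplacian_chart_inv[OF M(1) zw M(3) h, symmetric])
      also have "\<dots> = laplacian F (T (chart_inv c (z, w)))"
        by (rule inv[OF F]) (use zw in \<open>simp add: M_def\<close>)
      also have "\<dots> = 4 * ((1 - a (z, w) * b (z, w))\<^sup>2 * mixed (F \<circ> chart_inv d) (a (z, w)) (b (z, w)))"
        unfolding Gin(2)[OF zw]
        by (rule laplacian_chart_inv[OF open_coord_domain Gin(1)[OF zw] _ f]) auto
      also have "mixed (F \<circ> T \<circ> chart_inv c) z w
          = mixed (\<lambda>x. l (a x, b x) * m (a x, b x) * (1 / (1 - a x * b x)\<^sup>2)) z w"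
        by (rule mixed_cong[OF M(1) zw]) (use eq Ff Gin(1) in simp)
      also have "mixed (F \<circ> chart_inv d) (a (z, w)) (b (z, w)) = mixed ?f (a (z, w)) (b (z, w))"
        by (rule mixed_cong[OF open_coord_domain Gin(1)[OF zw]]) (use Ff in simp)
      finally show ?thesis by simp
    qed
    have "z * w \<noteq> 1" using zw M(3) by (auto simp: coord_domain_def)
    from conformal_equations[OF M(1) zw ab ne this key]
    show "dz a z w * dw a z w = 0" "dz b z w * dw b z w = 0"
      "(1 - z * w)\<^sup>2 * (dz a z w * dw b z w + dw a z w * dz b z w) = (1 - a (z, w) * b (z, w))\<^sup>2"
      by blast+
  qed
  obtain z0 w0 where zw0: "q = (z0, w0)" by (cases q)
  have q0: "(z0, w0) \<in> M" using M(2) zw0 by simp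
  obtain N A B C D where N: "open N" "(z0, w0) \<in> N" "N \<subseteq> M" and det: "A * D - B * C \<noteq> 0"
    and form: "(\<forall>(z, w)\<in>N. C * z + D \<noteq> 0 \<and> A + B * w \<noteq> 0 \<and>
        a (z, w) = (A * z + B) / (C * z + D) \<and> b (z, w) = (C + D * w) / (A + B * w)) \<or>
     (\<forall>(z, w)\<in>N. C * w + D \<noteq> 0 \<and> A + B * z \<noteq> 0 \<and>
        a (z, w) = (A * w + B) / (C * w + D) \<and> b (z, w) = (C + D * z) / (A + B * z))"
    by (rule local_isometry_is_moebius[OF M(1) q0 ab ne eqs])
  let ?\<psi> = "sphere_moebius A B C D"
  have \<psi>: "?\<psi> \<in> Aut_sphere" by (rule sphere_moebius_in_Aut[OF det])
  have "\<exists>R\<in>isometries. \<forall>x\<in>N. emb (a x, b x) = R (emb x)"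
    using form
  proof
    assume *: "\<forall>(z, w)\<in>N. C * z + D \<noteq> 0 \<and> A + B * w \<noteq> 0 \<and>
        a (z, w) = (A * z + B) / (C * z + D) \<and> b (z, w) = (C + D * w) / (A + B * w)"
    have "emb (a x, b x) = double_map ?\<psi> (emb x)" if "x \<in> N" for x
      using * that by (subst double_map_emb) (auto simp: moebius_pair_domain_def moebius_pair_def)
    then show ?thesis using \<psi> by (auto simp: isometries_def)
  next
    assume *: "\<forall>(z, w)\<in>N. C * w + D \<noteq> 0 \<and> A + B * z \<noteq> 0 \<and>
        a (z, w) = (A * w + B) / (C * w + D) \<and> b (z, w) = (C + D * z) / (A + B * z)"
    have "emb (a x, b x) = (double_map ?\<psi> \<circ> prod.swap) (emb x)" if "x \<in> N" for x
    proof -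
      have "prod.swap (emb x) = emb (prod.swap x)" by (simp add: emb_def prod.swap_def)
      moreover have "emb (a x, b x) = double_map ?\<psi> (emb (prod.swap x))"
        using * that by (subst double_map_emb) (auto simp: moebius_pair_domain_def moebius_pair_def)
      ultimately show ?thesis by simp
    qed
    moreover have "double_map ?\<psi> \<circ> prod.swap \<in> isometries" using \<psi> by (simp add: isometries_def)
    ultimately show ?thesis by blast
  qed
  then obtain R where R: "R \<in> isometries" and RN: "\<forall>x\<in>N. emb (a x, b x) = R (emb x)" by blast
  show ?thesis
  proof (rule that[of "chart_inv c ` N" "chart_flip d \<circ> R \<circ> chart_flip c"])
    show "openin Omega_topology (chart_inv c ` N)"
      using N(1) N(3) M(3) by (intro openin_chart_inv_image) auto
    show "p \<in> chart_inv c ` N" using N(2) zw0 q(2) by blast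
    show "chart_inv c ` N \<subseteq> U" using N(3) by (auto simp: M_def)
    show "chart_flip d \<circ> R \<circ> chart_flip c \<in> isometries" by (rule isometries_chart_flip[OF R])
    show "\<forall>x\<in>chart_inv c ` N. T x = (chart_flip d \<circ> R \<circ> chart_flip c) x"
    proof
      fix x assume "x \<in> chart_inv c ` N"
      then obtain y where y: "y \<in> N" "x = chart_inv c y" by blast
      then have yM: "y \<in> M" "y \<in> coord_domain" using N(3) M(3) by auto
      show "T x = (chart_flip d \<circ> R \<circ> chart_flip c) x"
        using Gin[OF yM(1)] RN y yM(2) by (simp add: chart_inv_eq)
    qed
  qed
qed

theorem theorem5p2:
  fixes U :: "(sphere \<times> sphere) set" and T :: "sphere \<times> sphere \<Rightarrow> sphere \<times> sphere"
  assumes "subdomain U" and "holomorphic_mapping U T"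
  shows "(\<forall>F\<in>holomorphic_functions Omega. \<forall>p\<in>U. laplacian (F \<circ> T) p = laplacian F (T p))
     \<longleftrightarrow> (\<exists>S\<in>moebius_group. \<forall>p\<in>U. T p = S p)"
proof
  have U: "openin Omega_topology U" "connectedin Omega_topology U" "U \<noteq> {}"
    using assms(1) by (auto simp: subdomain_def)
  have UO: "U \<subseteq> Omega" using openin_subset[OF U(1)] by simp
  {
    assume "\<exists>S\<in>moebius_group. \<forall>p\<in>U. T p = S p"
    then obtain S where S: "S \<in> moebius_group" "\<forall>p\<in>U. T p = S p" by blast
    obtain S' where S': "S' \<in> isometries" "\<forall>p\<in>Omega. S p = S' p"
      by (rule moebius_group_isometry[OF S(1)])
    have "T p = S' p" if "p \<in> U" for p
      using that S(2) S'(2) UO by (metis subsetD)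
    then show "\<forall>F\<in>holomorphic_functions Omega. \<forall>p\<in>U. laplacian (F \<circ> T) p = laplacian F (T p)"
      using laplacian_comp_isometry[OF S'(1) U(1)] by blast
  next
    assume inv: "\<forall>F\<in>holomorphic_functions Omega. \<forall>p\<in>U. laplacian (F \<circ> T) p = laplacian F (T p)"
    define agree where "agree S V \<longleftrightarrow> openin Omega_topology V \<and> V \<subseteq> U \<and> (\<forall>x\<in>V. T x = S x)" for S V
    have loc: "\<exists>V S. agree S V \<and> p \<in> V \<and> S \<in> isometries" if p: "p \<in> U" for p
    proof -
      obtain V S where "openin Omega_topology V" "p \<in> V" "V \<subseteq> U" "S \<in> isometries" "\<forall>x\<in>V. T x = S x"
        by (rule laplacian_invariant_imp_locally_isometry[OF U(1) assms(2) _ p]) (use inv in auto)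
      then show ?thesis unfolding agree_def by blast
    qed
    obtain p0 where p0: "p0 \<in> U" using U(3) by blast
    obtain V0 S0 where V0: "agree S0 V0" "p0 \<in> V0" and S0: "S0 \<in> isometries" using loc[OF p0] by blast
    \<comment> \<open>By uniqueness, points near which \<open>T\<close> is \<open>S0\<close> and points near which it is another element
      form disjoint open sets.\<close>
    define E1 where "E1 = \<Union>{V. agree S0 V}"
    define E2 where "E2 = \<Union>{V. \<exists>S\<in>isometries. S \<noteq> S0 \<and> agree S V}"
    have o: "openin Omega_topology E1" "openin Omega_topology E2"
      unfolding E1_def E2_def by (auto intro!: openin_Union simp: agree_def)
    have cov: "U \<subseteq> E1 \<union> E2"
    proof
      fix p assume "p \<in> U"
      then obtain V S where "agree S V" "p \<in> V" "S \<in> isometries" using loc by blast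
      then show "p \<in> E1 \<union> E2" unfolding E1_def E2_def by (cases "S = S0") auto
    qed
    have disj: "E1 \<inter> E2 = {}"
    proof (rule ccontr)
      assume "E1 \<inter> E2 \<noteq> {}"
      then obtain x V W S where x: "x \<in> V" "x \<in> W" and V: "agree S0 V" and W: "agree S W"
        and S: "S \<in> isometries" "S \<noteq> S0"
        unfolding E1_def E2_def by blast
      have "S = S0"
      proof (rule isometries_eqI[OF S(1) S0])
        show "openin Omega_topology (V \<inter> W)" using V W by (auto simp: agree_def)
        show "V \<inter> W \<noteq> {}" using x by blast
        show "S p = S0 p" if "p \<in> V \<inter> W" for p
          using that V W unfolding agree_def by (metis IntD1 IntD2)
      qed
      then show False using S(2) by simp
    qed
    have "p0 \<in> E1" using V0 by (auto simp: E1_def)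
    then have "E2 \<inter> U = {}"
      using U(2) o cov disj p0 unfolding connectedin by blast
    then have "T p = S0 p" if "p \<in> U" for p
      using cov that unfolding E1_def agree_def by blast
    then show "\<exists>S\<in>moebius_group. \<forall>p\<in>U. T p = S p"
      using S0 isometries_subset_moebius_group by blast
  }
qed

end
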